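(* Let $p\ge3$ and $d\ge2$ be integers, $n_1,\dots,n_{d-1}\ge1$ integers, $\sigma_1,\dots,\sigma_d>0$ fixed scales, and $\boldsymbol{x}\ne\boldsymbol{0}$ a fixed input vector. Let $\pi$ be the fixed-scale ReLU BNN prior density on $\mathbb{R}^p$ (defined in the context) and let $$m(\boldsymbol{y})=\int_{\mathbb{R}^p}(2\pi_0)^{-p/2}e^{-\|\boldsymbol{y}-\boldsymbol{\theta}\|^2/2}\,\pi(\boldsymbol{\theta})\,d\boldsymbol{\theta},\qquad \boldsymbol{y}\in\mathbb{R}^p,$$ be the induced marginal density, where $\pi_0=3.14159\ldots$. Then $\sqrt{m}$ is not superharmonic in $\mathbb{R}^p$; that is, it is not the case that $\Delta\sqrt{m(\boldsymbol{y})}\le0$ for all $\boldsymbol{y}\in\mathbb{R}^p$.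
   Context: $\Delta$ is the Laplacian on $\mathbb{R}^p$. Fixed-scale ReLU BNN prior (continuous part of the output density of a depth-$d$ bias-free fully connected ReLU network with hidden widths $n_1,\dots,n_{d-1}$, output dimension $n_d=p$, and independent $N(0,\sigma_\ell^2)$ weights in layer $\ell$; the atom at $\boldsymbol{0}_p$ is discarded): for $\boldsymbol{\theta}\ne\boldsymbol{0}_p$, with $B=2^d\sigma_1^2\cdots\sigma_d^2\|\boldsymbol{x}\|^2$, $$\pi(\boldsymbol{\theta})=\frac{1}{2^{n_1+\dots+n_{d-1}}}\sum_{k_1=1}^{n_1}\cdots\sum_{k_{d-1}=1}^{n_{d-1}}\binom{n_1}{k_1}\cdots\binom{n_{d-1}}{k_{d-1}}\frac{\prod_{\ell=1}^{d-1}\Gamma(k_\ell/2)^{-1}}{(\pi_0 B)^{p/2}}\;G^{d,0}_{0,d}\!\left(\frac{\|\boldsymbol{\theta}\|^2}{B}\;\Big|\;0,\tfrac{k_1-p}{2},\dots,\tfrac{k_{d-1}-p}{2}\right),$$ where $G^{d,0}_{0,d}$ is the Meijer G-function, $G^{d,0}_{0,d}(z\mid b_1,\dots,b_d)=\frac{1}{2\pi_0 i}\int_{c-i\infty}^{c+i\infty}\prod_{j=1}^d\Gamma(b_j+s)\,z^{-s}\,ds$ for $z>0$, with $c>\max_j(-b_j)$. This $\pi$ has finite total mass $\prod_{\ell=1}^{d-1}(2^{n_\ell}-1)/2^{n_1+\dots+n_{d-1}}$, not normalized to one. *)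

theory Defs
  imports "HOL-Analysis.Analysis"
begin

text \<open>
  The Meijer function \<open>G\<^bsup>d,0\<^esup>\<^bsub>0,d\<^esub>(z | bs)\<close> with \<open>d = length bs\<close>, for \<open>z > 0\<close>.  The contour is the
  vertical line \<open>s = c + i t\<close>, \<open>ds = i dt\<close>, for an arbitrary \<open>c\<close> to the right of all points \<open>-b\<close>;
  the integral does not depend on which such \<open>c\<close> is chosen.
\<close>

definition meijer_G :: "real list \<Rightarrow> real \<Rightarrow> complex" where
  "meijer_G bs z =
     (let c = (SOME c::real. \<forall>b\<in>set bs. c > - b)
      in 1 / (2 * of_real pi * \<i>) *
         (\<integral>t. (\<Prod>b\<leftarrow>bs. Gamma (of_real b + Complex c t)) *
               of_real z powr (- Complex c t) * \<i> \<partial>lborel))"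

text \<open>
  \<open>n l\<close> is the width of hidden layer \<open>l \<in> {1..d-1}\<close> and \<open>\<sigma> l\<close> the weight scale of layer
  \<open>l \<in> {1..d}\<close>; other arguments are irrelevant.  The iterated sum over \<open>k\<^sub>1, \<dots>\<close> is a
  single sum over all tuples \<open>k\<close>.  \<open>meijer_G\<close> is real-valued at real data, so \<open>Re\<close> only changes
  the type.  The value at the origin is immaterial, because the density is only used under integrals.
\<close>

definition bnn_B :: "nat \<Rightarrow> (nat \<Rightarrow> real) \<Rightarrow> real ^ 'q \<Rightarrow> real" where
  "bnn_B d \<sigma> x = 2 ^ d * (\<Prod>l\<in>{1..d}. (\<sigma> l)\<^sup>2) * (norm x)\<^sup>2"

definition bnn_prior ::
  "nat \<Rightarrow> (nat \<Rightarrow> nat) \<Rightarrow> (nat \<Rightarrow> real) \<Rightarrow> real ^ 'q \<Rightarrow> real ^ 'p \<Rightarrow> real" where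
  "bnn_prior d n \<sigma> x \<theta> =
     (if \<theta> = 0 then 0 else
      (let p = real CARD('p); B = bnn_B d \<sigma> x in
       1 / 2 ^ (\<Sum>l\<in>{1..d-1}. n l) *
       (\<Sum>k\<in>(\<Pi>\<^sub>E l\<in>{1..d-1}. {1..n l}).
          (\<Prod>l\<in>{1..d-1}. real (n l choose k l)) *
          ((\<Prod>l\<in>{1..d-1}. inverse (Gamma (real (k l) / 2))) / (pi * B) powr (p / 2)) *
          Re (meijer_G (0 # map (\<lambda>l. (real (k l) - p) / 2) [1..<d]) ((norm \<theta>)\<^sup>2 / B)))))"

definition gaussian_marginal :: "(real ^ 'p \<Rightarrow> real) \<Rightarrow> real ^ 'p \<Rightarrow> real" where
  "gaussian_marginal \<rho> y =
     (\<integral>\<theta>. (2 * pi) powr (- (real CARD('p) / 2)) * exp (- ((norm (y - \<theta>))\<^sup>2 / 2)) * \<rho> \<theta> \<partial>lborel)"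

definition partial_deriv :: "'p::finite \<Rightarrow> (real ^ 'p \<Rightarrow> real) \<Rightarrow> real ^ 'p \<Rightarrow> real" where
  "partial_deriv i f y = deriv (\<lambda>t. f (y + t *\<^sub>R axis i 1)) 0"

definition laplacian :: "(real ^ 'p \<Rightarrow> real) \<Rightarrow> real ^ 'p \<Rightarrow> real" where
  "laplacian f y = (\<Sum>i\<in>UNIV. partial_deriv i (partial_deriv i f) y)"

end

theory Submission
  imports Defs "HOL-Probability.Probability"
begin

text \<open>
  By Mellin inversion the Meijer function is a Laplace-type mixture
  \<open>\<integral>exp (- q x - z exp (- x)) d\<mu>(x)\<close>, where \<open>\<mu>\<close> is the unnormalised law of a sum of logarithms of
  independent Gamma variables. Hence the prior is a scale mixture of centred normal densities,
  and its Gaussian convolution is \<open>m(y) = L(\<parallel>y\<parallel>\<^sup>2)\<close> with \<open>L\<close> a positive combination of Laplace transforms.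
  As all moments of the mixing variances are finite, \<open>m\<close> decays faster than every power of \<open>\<parallel>y\<parallel>\<close>.
  On the other hand, a positive non-constant radial superharmonic function on \<open>\<real>\<^sup>p\<close>, \<open>p \<ge> 3\<close>, is bounded below
  by a multiple of the fundamental solution \<open>\<parallel>y\<parallel>\<^bsup>2-p\<^esup>\<close>, so \<open>sqrt m\<close> cannot be superharmonic.
\<close>

section \<open>Mellin inversion for the Gamma function\<close>

text \<open>This is Euler's integral after the substitution \<open>t = exp x\<close>. Along a
  vertical line of real part c > 0, Gamma becomes the Fourier transform of
  \<open>exp (c * x - exp x)\<close>, so Mellin inversion turns into Fourier inversion.\<close>

lemma log_gamma_integral:
  assumes s: "Re s > 0"
  shows "integrable lborel (\<lambda>x::real. exp (s * of_real x - of_real (exp x)))"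
    and "(\<integral>x. exp (s * of_real x - of_real (exp x)) \<partial>lborel) = Gamma s"
proof -
  define f :: "real \<Rightarrow> complex" where "f = (\<lambda>t. of_real t powr (s - 1) / of_real (exp t))"
  let ?h = "\<lambda>x::real. exp (s * of_real x - of_real (exp x)) :: complex"
  have im: "exp ` (UNIV::real set) = {0<..}"
    by (auto simp: image_iff intro: exp_ln[symmetric])
  have eq: "(\<lambda>x. exp x *\<^sub>R f (exp x)) = ?h"
    by (auto simp: f_def powr_def scaleR_conv_of_real Ln_of_real exp_diff exp_of_real
        left_diff_distrib field_simps)
  have a: "f absolutely_integrable_on exp ` (UNIV::real set)"
    unfolding im f_def using s by (rule absolutely_integrable_Gamma_integral')
  have i: "integral (exp ` (UNIV::real set)) f = Gamma s"
    unfolding im f_def using Gamma_integral_complex'[OF s] by (rule integral_unique)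
  have inj_on_exp: "inj_on exp (UNIV :: real set)"
    by (simp add: inj_on_def)
  have d: "(exp has_field_derivative exp x) (at x within UNIV)" for x :: real
    by (auto intro!: derivative_eq_intros)
  have "?h absolutely_integrable_on UNIV \<and> integral UNIV ?h = Gamma s"
    using has_absolute_integral_change_of_variables_real[of UNIV exp exp f "Gamma s", OF _ d inj_on_exp] a i
    by (simp add: eq[symmetric])
  then have A: "?h absolutely_integrable_on UNIV" and I: "integral UNIV ?h = Gamma s"
    by blast+
  have m: "?h \<in> borel_measurable borel" by measurable
  show int: "integrable lborel ?h"
    using A m by (simp add: set_integrable_def integrable_completion)
  show "integral\<^sup>L lborel ?h = Gamma s"
    using I set_lebesgue_integral_eq_integral(2)[OF A] m
    by (simp add: set_lebesgue_integral_def integral_completion)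
qed

text \<open>The modulus of the integrand in \<open>log_gamma_integral\<close> depends on
  \<open>s\<close> only through \<open>Re s\<close>.\<close>

lemma norm_Gamma_le:
  assumes c: "Re s > 0" shows "norm (Gamma s) \<le> Gamma (Re s)"
proof -
  have r: "Re (of_real (Re s) :: complex) > 0" using c by simp
  have "norm (Gamma s) \<le> (\<integral>x. norm (exp (s * of_real x - of_real (exp x))) \<partial>lborel)"
    unfolding log_gamma_integral(2)[OF c, symmetric] by (rule integral_norm_bound)
  also have "\<dots> = Re (\<integral>x. exp (of_real (Re s) * of_real x - of_real (exp x)) \<partial>lborel)"
    by (subst integral_Re[OF log_gamma_integral(1)[OF r], symmetric]) (simp add: Re_exp exp_of_real)
  also have "\<dots> = Gamma (Re s)"
    using log_gamma_integral(2)[OF r] by (simp add: Gamma_complex_of_real)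
  finally show ?thesis .
qed

lemma Gamma_vertical_measurable:
  assumes c: "c > 0" shows "(\<lambda>t. Gamma (Complex c t)) \<in> borel_measurable borel"
proof (intro borel_measurable_continuous_onI continuous_on_compose2[OF continuous_on_Gamma])
  show "continuous_on UNIV (Complex c)"
    by (simp add: Complex_eq) (intro continuous_intros)
  show "range (Complex c) \<subseteq> {s. Re s > 0}" using c by auto
qed (auto elim!: nonpos_Ints_cases)

text \<open>Two applications of the functional equation give
  \<open>Gamma s = Gamma (s + 2) / (s * (s + 1))\<close>. The numerator is bounded on the line by
  \<open>norm_Gamma_le\<close>, and the denominator grows quadratically.\<close>

lemma Gamma_vertical_integrable:
  assumes c: "c > 0" shows "integrable lborel (\<lambda>t. Gamma (Complex c t))"
proof (rule Bochner_Integration.integrable_bound)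
  \<comment> \<open>The minimum compares \<open>c\<^sup>2 + t\<^sup>2\<close> from below with a
    multiple of \<open>1 + t\<^sup>2\<close>.\<close>
  define K where "K = Gamma (c + 2) / min 1 (c\<^sup>2)"
  show "integrable lborel (\<lambda>t. K * inverse (1 + t\<^sup>2))"
    using integrable_inverse_1_plus_square by (simp add: set_integrable_def)
  show "(\<lambda>t. Gamma (Complex c t)) \<in> borel_measurable lborel"
    using Gamma_vertical_measurable[OF c] by simp
  have "norm (Gamma (Complex c t)) \<le> K * inverse (1 + t\<^sup>2)" for t
  proof -
    define s where "s = Complex c t"
    have Re: "Re s = c" by (simp add: s_def)
    have ni: "s \<notin> \<int>\<^sub>\<le>\<^sub>0" "s + 1 \<notin> \<int>\<^sub>\<le>\<^sub>0"
      using c Re by (auto elim!: nonpos_Ints_cases simp: complex_eq_iff)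
    have "Gamma (s + 2) = (s + 1) * s * Gamma s"
      using Gamma_plus1[OF ni(1)] Gamma_plus1[OF ni(2)] by (simp add: add.assoc)
    then have "norm (s + 1) * norm s * norm (Gamma s) = norm (Gamma (s + 2))"
      by (simp add: norm_mult)
    also have "\<dots> \<le> Gamma (c + 2)" using norm_Gamma_le[of "s + 2"] c Re by simp
    finally have 1: "norm (s + 1) * norm s * norm (Gamma s) \<le> Gamma (c + 2)" .
    have "norm s \<le> norm (s + 1)" unfolding cmod_def s_def using c
      by (intro real_sqrt_le_mono) (auto simp: power2_eq_square algebra_simps)
    then have "norm s * norm s \<le> norm (s + 1) * norm s" by (intro mult_right_mono) auto
    moreover have "norm s * norm s = c\<^sup>2 + t\<^sup>2"
      by (simp add: s_def cmod_def)
    moreover have "min 1 (c\<^sup>2) * (1 + t\<^sup>2) \<le> c\<^sup>2 + t\<^sup>2"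
    proof -
      have "min 1 (c\<^sup>2) * t\<^sup>2 \<le> 1 * t\<^sup>2" by (intro mult_right_mono) auto
      then show ?thesis by (simp add: distrib_left)
    qed
    ultimately have "min 1 (c\<^sup>2) * (1 + t\<^sup>2) \<le> norm (s + 1) * norm s" by linarith
    then have "min 1 (c\<^sup>2) * (1 + t\<^sup>2) * norm (Gamma s) \<le> norm (s + 1) * norm s * norm (Gamma s)"
      by (intro mult_right_mono) auto
    also note 1
    finally have 2: "norm (Gamma s) * (min 1 (c\<^sup>2) * (1 + t\<^sup>2)) \<le> Gamma (c + 2)" by (simp add: mult_ac)
    have "0 < min 1 (c\<^sup>2) * (1 + t\<^sup>2)"
      using c by (intro mult_pos_pos) (auto intro: add_pos_nonneg)
    from 2 this have "norm (Gamma s) \<le> Gamma (c + 2) / (min 1 (c\<^sup>2) * (1 + t\<^sup>2))"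
      by (subst pos_le_divide_eq)
    then show ?thesis by (simp add: K_def s_def divide_inverse mult_ac)
  qed
  then show "AE t in lborel. norm (Gamma (Complex c t)) \<le> norm (K * inverse (1 + t\<^sup>2))"
    by (intro AE_I2) (metis abs_ge_self order_trans real_norm_def)
qed

text \<open>The characteristic function of the standard normal law at \<open>a / d\<close>, after
  rescaling the variable by \<open>d\<close>.\<close>

lemma gaussian_Fourier:
  assumes d: "d > 0"
  shows "(\<integral>t. exp (\<i> * of_real (t * a)) * of_real (exp (- (d * t)\<^sup>2 / 2)) \<partial>lborel) =
    complex_of_real (sqrt (2 * pi) / d * exp (- (a / d)\<^sup>2 / 2))"
proof -
  let ?g = "\<lambda>x::real. exp (\<i> * of_real (a / d * x)) * complex_of_real (exp (- x\<^sup>2 / 2))"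
  have "complex_of_real (exp (- (a / d)\<^sup>2 / 2)) = char std_normal_distribution (a / d)"
    by (simp add: char_std_normal_distribution)
  also have "\<dots> = (\<integral>x. std_normal_density x *\<^sub>R exp (\<i> * of_real (a / d * x)) \<partial>lborel)"
    unfolding char_def by (subst integral_density) (auto simp: mult_ac)
  also have "\<dots> = (\<integral>x. complex_of_real (1 / sqrt (2 * pi)) * ?g x \<partial>lborel)"
    by (intro Bochner_Integration.integral_cong) 
      (auto simp: std_normal_density_def scaleR_conv_of_real)
  also have "\<dots> = complex_of_real (1 / sqrt (2 * pi)) * (\<integral>x. ?g x \<partial>lborel)"
    by (rule integral_mult_right_zero)
  finally have "(\<integral>x. ?g x \<partial>lborel) = complex_of_real (sqrt (2 * pi)) * complex_of_real (exp (- (a / d)\<^sup>2 / 2))"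
    by (simp add: field_simps flip: of_real_mult)
  moreover have "(\<integral>x. ?g x \<partial>lborel) = \<bar>d\<bar> *\<^sub>R (\<integral>x. ?g (0 + d * x) \<partial>lborel)"
    using d by (intro lborel_integral_real_affine) auto
  ultimately show ?thesis using d by (simp add: scaleR_conv_of_real field_simps)
qed

text \<open>
  The Gaussian factor makes Fubini applicable and turns the inverse Fourier integral into a
  convolution with an approximate identity of width \<open>d\<close>, to be sent to \<open>0\<close>.
\<close>

lemma Gamma_Mellin_inversion_regularized:
  assumes c: "c > 0" and d: "d > 0"
  shows "(\<integral>t. Gamma (Complex c t) * exp (- \<i> * of_real (t * y)) * of_real (exp (- (d * t)\<^sup>2 / 2)) \<partial>lborel)
    = of_real (sqrt (2 * pi) * (\<integral>w. exp (c * (y + d * w) - exp (y + d * w)) * exp (- w\<^sup>2 / 2) \<partial>lborel))"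
proof -
  let ?N = "\<lambda>t. complex_of_real (exp (- (d * t)\<^sup>2 / 2))"
  let ?f = "\<lambda>t x. exp (Complex c t * of_real x - of_real (exp x)) * exp (- \<i> * of_real (t * y)) * ?N t"
  \<comment> \<open>In this factored form the modulus splits into a function of \<open>x\<close>
    times a function of \<open>t\<close>, and the \<open>t\<close>-integral is the one of
    \<open>gaussian_Fourier\<close> at \<open>x - y\<close>.\<close>
  have f: "?f t x = of_real (exp (c * x - exp x)) * (exp (\<i> * of_real (t * (x - y))) * ?N t)" for t x
    by (simp add: Complex_eq algebra_simps exp_add[symmetric] exp_diff exp_of_real[symmetric] divide_simps) 
  have r: "integrable lborel (\<lambda>x. exp (c * x - exp x))"
    using integrable_norm[OF log_gamma_integral(1)[of "of_real c"]] c by (simp add: exp_of_real)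
  have n: "integrable lborel (\<lambda>t. exp (- (d * t)\<^sup>2 / 2))"
  proof -
    have "integrable lborel (\<lambda>t. sqrt (2 * pi) * std_normal_density t)" by simp
    then have "integrable lborel (\<lambda>t::real. exp (- t\<^sup>2 / 2))"
      unfolding std_normal_density_def by (simp add: mult.assoc[symmetric])
    from lborel_integrable_real_affine[OF this, of d 0] d show ?thesis by simp
  qed
  have m: "case_prod ?f \<in> borel_measurable (lborel \<Otimes>\<^sub>M lborel)"
    unfolding f by measurable
  have nf: "norm (?f t x) = exp (c * x - exp x) * exp (- (d * t)\<^sup>2 / 2)" for t x
    unfolding f by (simp add: norm_mult)
  have "integrable (lborel \<Otimes>\<^sub>M lborel) (case_prod ?f)"
    using m
  proof (rule lborel_pair.Fubini_integrable)
    show "integrable lborel (\<lambda>t. \<integral>x. norm (case (t, x) of (t, x) \<Rightarrow> ?f t x) \<partial>lborel)"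
      unfolding prod.case nf using n by simp
    have "integrable lborel (?f t)" for t
    proof (rule Bochner_Integration.integrable_bound[OF r])
      show "?f t \<in> borel_measurable lborel" unfolding f by measurable
    qed (simp only: nf, simp)
    then show "AE t in lborel. integrable lborel (\<lambda>x. case (t, x) of (t, x) \<Rightarrow> ?f t x)"
      by simp
  qed
  then have "(\<integral>x. (\<integral>t. ?f t x \<partial>lborel) \<partial>lborel) = (\<integral>t. (\<integral>x. ?f t x \<partial>lborel) \<partial>lborel)"
    by (rule lborel_pair.Fubini_integral)
  also have "(\<lambda>t. \<integral>x. ?f t x \<partial>lborel) = (\<lambda>t. Gamma (Complex c t) * exp (- \<i> * of_real (t * y)) * ?N t)"
    using c by (auto simp: log_gamma_integral(2))
  also have "(\<lambda>x. \<integral>t. ?f t x \<partial>lborel) =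
      (\<lambda>x. complex_of_real (exp (c * x - exp x) * (sqrt (2 * pi) / d * exp (- ((x - y) / d)\<^sup>2 / 2))))"
    unfolding f integral_mult_right_zero gaussian_Fourier[OF d] by simp
  also have "(\<integral>x. complex_of_real (exp (c * x - exp x) * (sqrt (2 * pi) / d * exp (- ((x - y) / d)\<^sup>2 / 2))) \<partial>lborel)
     = of_real (\<integral>x. exp (c * x - exp x) * (sqrt (2 * pi) / d * exp (- ((x - y) / d)\<^sup>2 / 2)) \<partial>lborel)"
    by (rule integral_complex_of_real)
  \<comment> \<open>The substitution \<open>x = y + d * w\<close> moves the width \<open>d\<close>
    from the Gaussian into the argument of the density.\<close>
  also have "(\<integral>x. exp (c * x - exp x) * (sqrt (2 * pi) / d * exp (- ((x - y) / d)\<^sup>2 / 2)) \<partial>lborel)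
     = \<bar>d\<bar> *\<^sub>R (\<integral>w. exp (c * (y + d * w) - exp (y + d * w)) * (sqrt (2 * pi) / d * exp (- (((y + d * w) - y) / d)\<^sup>2 / 2)) \<partial>lborel)"
    using d by (intro lborel_integral_real_affine) auto
  also have "\<dots> = sqrt (2 * pi) * (\<integral>w. exp (c * (y + d * w) - exp (y + d * w)) * exp (- w\<^sup>2 / 2) \<partial>lborel)"
    using d by (simp add: integral_mult_right_zero[symmetric] field_simps del: integral_mult_right_zero)
  finally show ?thesis by simp
qed

text \<open>The tangent inequality \<open>1 + h \<le> exp h\<close>, centred at the maximiser
  \<open>x = ln c\<close>. Being uniform in \<open>x\<close>, the bound dominates the regularized
  integrands for all widths at once.\<close>

lemma exp_mult_minus_exp_le:
  fixes c :: real assumes "c > 0" shows "exp (c * x - exp x) \<le> exp (c * ln c)"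
proof -
  have "1 + (x - ln c) \<le> exp (x - ln c)" by (rule exp_ge_add_one_self)
  then have "c * (x - ln c) \<le> exp x - c"
    using assms by (simp add: exp_diff field_simps)
  then show ?thesis using assms by (simp add: algebra_simps)
qed

text \<open>The width of the regularization tends to 0 along \<open>e n\<close>. Dominated
  convergence applies on both sides, with the integrable modulus of Gamma on the left and a multiple
  of \<open>exp (- w\<^sup>2 / 2)\<close> on the right.\<close>

lemma Gamma_Mellin_inversion:
  assumes c: "c > 0"
  shows "(\<integral>t. Gamma (Complex c t) * exp (- \<i> * of_real (t * y)) \<partial>lborel)
    = of_real (2 * pi * exp (c * y - exp y))"
proof -
  define e :: "nat \<Rightarrow> real" where "e = (\<lambda>n. 1 / real (Suc n))"
  have e: "e \<longlonglongrightarrow> 0" unfolding e_def by (rule LIMSEQ_Suc[OF lim_1_over_n])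
  have e0: "e n > 0" for n by (simp add: e_def)
  let ?L = "\<lambda>n t. Gamma (Complex c t) * exp (- \<i> * of_real (t * y)) * of_real (exp (- (e n * t)\<^sup>2 / 2))"
  let ?R = "\<lambda>n w. exp (c * (y + e n * w) - exp (y + e n * w)) * exp (- w\<^sup>2 / 2)"
  have gm[measurable]: "(\<lambda>t. Gamma (Complex c t)) \<in> borel_measurable borel"
    by (rule Gamma_vertical_measurable[OF c])
  have 1: "(\<lambda>n. \<integral>t. ?L n t \<partial>lborel) \<longlonglongrightarrow> (\<integral>t. Gamma (Complex c t) * exp (- \<i> * of_real (t * y)) \<partial>lborel)"
  proof (rule integral_dominated_convergence)
    show "integrable lborel (\<lambda>t. norm (Gamma (Complex c t)))"
      using Gamma_vertical_integrable[OF c] by (rule integrable_norm)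
    have "(\<lambda>n. ?L n t) \<longlonglongrightarrow> Gamma (Complex c t) * exp (- \<i> * of_real (t * y)) * of_real (exp (- (0 * t)\<^sup>2 / 2))" for t
      by (intro tendsto_intros e) simp_all
    then show "AE t in lborel. (\<lambda>n. ?L n t) \<longlonglongrightarrow> Gamma (Complex c t) * exp (- \<i> * of_real (t * y))"
      by simp
    show "AE t in lborel. norm (?L n t) \<le> norm (Gamma (Complex c t))" for n
      by (auto simp: norm_mult intro!: mult_left_le)
  qed measurable
  have i: "integrable lborel (\<lambda>w::real. exp (- w\<^sup>2 / 2))"
    and iv: "(\<integral>w. exp (- w\<^sup>2 / 2) \<partial>lborel) = sqrt (2 * pi :: real)"
  proof -
    have *: "(\<lambda>w::real. exp (- w\<^sup>2 / 2)) = (\<lambda>w. sqrt (2 * pi) * std_normal_density w)"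
      by (simp add: std_normal_density_def)
    show "integrable lborel (\<lambda>w::real. exp (- w\<^sup>2 / 2))" unfolding * by simp
    show "(\<integral>w. exp (- w\<^sup>2 / 2) \<partial>lborel) = sqrt (2 * pi :: real)" unfolding * by simp
  qed
  have "(\<lambda>n. \<integral>w. ?R n w \<partial>lborel) \<longlonglongrightarrow> (\<integral>w. exp (c * y - exp y) * exp (- w\<^sup>2 / 2) \<partial>lborel)"
  proof (rule integral_dominated_convergence)
    show "integrable lborel (\<lambda>w. exp (c * ln c) * exp (- w\<^sup>2 / 2))" using i by simp
    have "(\<lambda>n. ?R n w) \<longlonglongrightarrow> exp (c * (y + 0 * w) - exp (y + 0 * w)) * exp (- w\<^sup>2 / 2)" for w
      by (intro tendsto_intros e) 
    then show "AE w in lborel. (\<lambda>n. ?R n w) \<longlonglongrightarrow> exp (c * y - exp y) * exp (- w\<^sup>2 / 2)"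
      by simp
    show "AE w in lborel. norm (?R n w) \<le> exp (c * ln c) * exp (- w\<^sup>2 / 2)" for n
      using exp_mult_minus_exp_le[OF c] by (auto intro!: mult_right_mono)
  qed measurable
  then have 2: "(\<lambda>n. complex_of_real (sqrt (2 * pi) * (\<integral>w. ?R n w \<partial>lborel)))
      \<longlonglongrightarrow> of_real (sqrt (2 * pi) * (exp (c * y - exp y) * sqrt (2 * pi)))"
    unfolding integral_mult_right_zero iv by (intro tendsto_intros)
  have "(\<integral>t. Gamma (Complex c t) * exp (- \<i> * of_real (t * y)) \<partial>lborel)
      = of_real (sqrt (2 * pi) * (exp (c * y - exp y) * sqrt (2 * pi)))"
    using 1 2 unfolding Gamma_Mellin_inversion_regularized[OF c e0] by (rule LIMSEQ_unique)
  then show ?thesis by (simp add: mult_ac flip: of_real_mult)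
qed

section \<open>Mixture representation of the Meijer function\<close>

text \<open>For \<open>a > 0\<close> this is \<open>Gamma a\<close> times the law of the logarithm
  of a Gamma variable of shape \<open>a\<close>. Without normalisation its exponential moments are
  exactly Gamma values.\<close>

definition log_gamma_measure :: "real \<Rightarrow> real measure" where
  "log_gamma_measure a = density lborel (\<lambda>x. ennreal (exp (a * x - exp x)))"

lemma sets_log_gamma_measure [simp, measurable_cong]: "sets (log_gamma_measure a) = sets borel"
  by (simp add: log_gamma_measure_def)

lemma sigma_finite_log_gamma_measure: "sigma_finite_measure (log_gamma_measure a)"
  unfolding log_gamma_measure_def
  by (rule sigma_finite_measure.sigma_finite_iff_density_finite'[OF lborel.sigma_finite_measure_axioms, THEN iffD2]) auto

lemma log_gamma_measure_exp:
  assumes "Re s > - a"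
  shows "integrable (log_gamma_measure a) (\<lambda>x. exp (s * complex_of_real x))"
    and "(\<integral>x. exp (s * complex_of_real x) \<partial>log_gamma_measure a) = Gamma (of_real a + s)"
proof -
  have *: "exp (a * x - exp x) *\<^sub>R exp (s * complex_of_real x)
      = exp ((of_real a + s) * of_real x - of_real (exp x))" for x
    by (simp add: scaleR_conv_of_real exp_of_real[symmetric] exp_add[symmetric] algebra_simps)
  have "Re (of_real a + s) > 0" using assms by simp
  note I = log_gamma_integral[OF this]
  show "integrable (log_gamma_measure a) (\<lambda>x. exp (s * complex_of_real x))"
    unfolding log_gamma_measure_def using I(1) by (subst integrable_density) (auto simp: *)
  show "(\<integral>x. exp (s * complex_of_real x) \<partial>log_gamma_measure a) = Gamma (of_real a + s)"
    unfolding log_gamma_measure_def using I(2) by (subst integral_density) (auto simp: *)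
qed

text \<open>An iterated convolution, encoded as the image of a product measure so that exponential
  moments factorise.\<close>

definition log_gamma_sum :: "'i set \<Rightarrow> ('i \<Rightarrow> real) \<Rightarrow> real measure" where
  "log_gamma_sum I a = distr (Pi\<^sub>M I (\<lambda>i. log_gamma_measure (a i))) borel (\<lambda>t. \<Sum>i\<in>I. t i)"

lemma sets_log_gamma_sum [simp, measurable_cong]: "sets (log_gamma_sum I a) = sets borel"
  by (simp add: log_gamma_sum_def)

lemma log_gamma_sum_exp:
  assumes I: "finite I" and s: "\<And>i. i \<in> I \<Longrightarrow> Re s > - a i"
  shows "integrable (log_gamma_sum I a) (\<lambda>x. exp (s * complex_of_real x))"
    and "(\<integral>x. exp (s * complex_of_real x) \<partial>log_gamma_sum I a) = (\<Prod>i\<in>I. Gamma (of_real (a i) + s))"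
proof -
  interpret product_sigma_finite "\<lambda>i. log_gamma_measure (a i)"
    by (simp add: product_sigma_finite_def sigma_finite_log_gamma_measure)
  have *: "exp (s * complex_of_real (\<Sum>i\<in>I. t i)) = (\<Prod>i\<in>I. exp (s * complex_of_real (t i)))" for t
    using I by (simp add: exp_sum[symmetric] sum_distrib_left)
  show "integrable (log_gamma_sum I a) (\<lambda>x. exp (s * complex_of_real x))"
    unfolding log_gamma_sum_def
    by (subst integrable_distr_eq)
      (auto simp only: * intro!: product_integrable_prod I log_gamma_measure_exp s, measurable)
  show "(\<integral>x. exp (s * complex_of_real x) \<partial>log_gamma_sum I a) = (\<Prod>i\<in>I. Gamma (of_real (a i) + s))"
    unfolding log_gamma_sum_def
  proof (subst integral_distr)
    have "(\<integral>t. (\<Prod>i\<in>I. exp (s * complex_of_real (t i))) \<partial>Pi\<^sub>M I (\<lambda>i. log_gamma_measure (a i)))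
        = (\<Prod>i\<in>I. \<integral>x. exp (s * complex_of_real x) \<partial>log_gamma_measure (a i))"
      using I by (rule product_integral_prod) (intro log_gamma_measure_exp s)
    also have "\<dots> = (\<Prod>i\<in>I. Gamma (of_real (a i) + s))"
      by (intro prod.cong refl log_gamma_measure_exp s)
    finally show "(\<integral>t. exp (s * complex_of_real (\<Sum>i\<in>I. t i)) \<partial>Pi\<^sub>M I (\<lambda>i. log_gamma_measure (a i)))
        = (\<Prod>i\<in>I. Gamma (of_real (a i) + s))"
      unfolding * .
  qed measurable
qed

lemma log_gamma_sum_exp_real:
  assumes I: "finite I" and r: "\<And>i. i \<in> I \<Longrightarrow> r > - a i"
  shows "integrable (log_gamma_sum I a) (\<lambda>x. exp (r * x))"
  using integrable_norm[OF log_gamma_sum_exp(1)[OF I, where s = "of_real r" and a = a]] r by simp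

text \<open>The total mass is the exponential moment of order 0, which is admissible because all
  \<open>a i\<close> are positive.\<close>

lemma finite_log_gamma_sum:
  assumes "finite I" "\<And>i. i \<in> I \<Longrightarrow> a i > 0"
  shows "finite_measure (log_gamma_sum I a)"
  using log_gamma_sum_exp_real[where I = I and r = 0 and a = a] assms
  by (auto intro!: finite_measureI simp: integrable_iff_bounded less_top[symmetric])

text \<open>Only the factor \<open>Gamma s\<close> belonging to the parameter 0 stays on the
  contour; the product of the others is the exponential moment of order \<open>s - q\<close> of
  \<open>log_gamma_sum\<close>. After Fubini the contour integral is the Mellin inversion of Gamma
  at \<open>ln z - x\<close>, which yields \<open>exp (- z * exp (- x))\<close>.\<close>

lemma meijer_G_eq_integral:
  fixes a :: "nat \<Rightarrow> real"
  assumes a: "\<And>l. l \<in> {1..<d} \<Longrightarrow> a l > 0" and z: "z > 0"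
  shows "meijer_G (0 # map (\<lambda>l. a l - q) [1..<d]) z
    = of_real (\<integral>x. exp (- q * x - z * exp (- x)) \<partial>log_gamma_sum {1..<d} a)"
proof -
  let ?bs = "0 # map (\<lambda>l. a l - q) [1..<d]"
  let ?\<mu> = "log_gamma_sum {1..<d} a"
  define c where "c = (SOME c::real. \<forall>b\<in>set ?bs. c > - b)"
  \<comment> \<open>A witness, so that the abscissa chosen in \<open>meijer_G\<close> really lies to
    the right of all the points.\<close>
  have "\<forall>b\<in>set ?bs. Max (uminus ` set ?bs) + 1 > - b"
    by (auto simp: less_le_trans[OF less_add_one] intro!: le_less_trans[OF Max_ge less_add_one])
  then have "\<exists>c::real. \<forall>b\<in>set ?bs. c > - b" by blast
  then have "\<forall>b\<in>set ?bs. c > - b" unfolding c_def by (rule someI_ex)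
  \<comment> \<open>The parameter 0 gives \<open>c > 0\<close>, as Mellin inversion requires; the
    other parameters make the moments of order \<open>c - q\<close> finite.\<close>
  then have c: "c > 0" and ca: "\<And>l. l \<in> {1..<d} \<Longrightarrow> c - q > - a l" by force+
  interpret mu: finite_measure ?\<mu> using a by (intro finite_log_gamma_sum) auto
  interpret pair_sigma_finite lborel ?\<mu> ..
  have gm[measurable]: "(\<lambda>t. Gamma (Complex c t)) \<in> borel_measurable borel"
    by (rule Gamma_vertical_measurable[OF c])
  let ?f = "\<lambda>t x. Gamma (Complex c t) * exp ((Complex c t - of_real q) * of_real x) * exp (- Complex c t * of_real (ln z))"
  have f: "?f t x = of_real (exp (- q * x + c * (x - ln z)))
      * (Gamma (Complex c t) * exp (- \<i> * of_real (t * (ln z - x))))" for t x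
    by (simp add: Complex_eq exp_of_real[symmetric] algebra_simps exp_add[symmetric])
  have nf: "norm (?f t x) = norm (Gamma (Complex c t)) * (exp ((c - q) * x) * exp (- c * ln z))" for t x
    by (simp add: norm_mult exp_add[symmetric] algebra_simps)
  have r: "integrable ?\<mu> (\<lambda>x. exp ((c - q) * x))"
    by (intro log_gamma_sum_exp_real ca) auto
  have mf: "case_prod ?f \<in> borel_measurable (lborel \<Otimes>\<^sub>M ?\<mu>)"
    unfolding f by measurable
  have "integrable (lborel \<Otimes>\<^sub>M ?\<mu>) (case_prod ?f)"
    using mf
  proof (rule Fubini_integrable)
    show "integrable lborel (\<lambda>t. \<integral>x. norm (case (t, x) of (t, x) \<Rightarrow> ?f t x) \<partial>?\<mu>)"
      unfolding prod.case nf using integrable_norm[OF Gamma_vertical_integrable[OF c]] by simp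
    have "integrable ?\<mu> (?f t)" for t
    proof (rule Bochner_Integration.integrable_bound)
      show "integrable ?\<mu> (\<lambda>x. norm (Gamma (Complex c t)) * (exp ((c - q) * x) * exp (- c * ln z)))"
        using r by simp
      show "?f t \<in> borel_measurable ?\<mu>" unfolding f by measurable
    qed (simp only: nf, simp)
    then show "AE t in lborel. integrable ?\<mu> (\<lambda>x. case (t, x) of (t, x) \<Rightarrow> ?f t x)" by simp
  qed
  then have F: "(\<integral>x. (\<integral>t. ?f t x \<partial>lborel) \<partial>?\<mu>) = (\<integral>t. (\<integral>x. ?f t x \<partial>?\<mu>) \<partial>lborel)"
    by (rule Fubini_integral)
  have 1: "(\<integral>t. ?f t x \<partial>lborel) = of_real (2 * pi * exp (- q * x - z * exp (- x)))" for x
  proof -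
    \<comment> \<open>The terms in \<open>c\<close> cancel against those of the inversion formula,
      so the result is free of the abscissa.\<close>
    have "- q * x - z * exp (- x) = (- q * x + c * (x - ln z)) + (c * (ln z - x) - exp (ln z - x))"
      using z by (simp add: exp_diff exp_minus divide_inverse algebra_simps)
    then show ?thesis
      unfolding f integral_mult_right_zero Gamma_Mellin_inversion[OF c] of_real_mult[symmetric]
      by (simp only: exp_add mult_ac)
  qed
  have 2: "(\<integral>x. ?f t x \<partial>?\<mu>)
      = (\<Prod>b\<leftarrow>?bs. Gamma (of_real b + Complex c t)) * of_real z powr (- Complex c t)" for t
  proof -
    have "(\<integral>x. exp ((Complex c t - of_real q) * of_real x) \<partial>?\<mu>)
        = (\<Prod>l\<in>{1..<d}. Gamma (of_real (a l) + (Complex c t - of_real q)))"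
      using ca by (intro log_gamma_sum_exp(2)) auto
    moreover have "(\<Prod>l\<in>{1..<d}. g l) = (\<Prod>l\<leftarrow>[1..<d]. g l)" for g :: "nat \<Rightarrow> complex"
      using prod.distinct_set_conv_list[of "[1..<d]" g] by simp
    ultimately show ?thesis
      using z by (simp add: powr_def Ln_of_real o_def algebra_simps)
  qed
  have "meijer_G ?bs z = 1 / (2 * of_real pi * \<i>) * (\<integral>t. (\<integral>x. ?f t x \<partial>?\<mu>) * \<i> \<partial>lborel)"
    unfolding meijer_G_def Let_def c_def[symmetric] 2 ..
  also have "\<dots> = 1 / (2 * of_real pi) * (\<integral>t. (\<integral>x. ?f t x \<partial>?\<mu>) \<partial>lborel)"
    unfolding integral_mult_left_zero by simp
  also have "\<dots> = 1 / (2 * of_real pi) * (\<integral>x. complex_of_real (2 * pi * exp (- q * x - z * exp (- x))) \<partial>?\<mu>)"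
    unfolding F[symmetric] 1 ..
  also have "\<dots> = of_real (\<integral>x. exp (- q * x - z * exp (- x)) \<partial>?\<mu>)"
    unfolding integral_complex_of_real by simp
  finally show ?thesis .
qed

section \<open>Gaussian convolution of normal scale mixtures\<close>

text \<open>The integrand is a product over coordinates of multiples of normal densities with
  variance \<open>1 / (2 * \<alpha>)\<close>.\<close>

lemma gaussian_integral:
  assumes \<alpha>: "\<alpha> > 0"
  shows "has_bochner_integral lborel (\<lambda>\<theta>::'a::euclidean_space. exp (- \<alpha> * (norm \<theta>)\<^sup>2))
    ((pi / \<alpha>) powr (real DIM('a) / 2))"
proof (rule has_bochner_integral_nn_integral)
  define \<sigma> where "\<sigma> = 1 / sqrt (2 * \<alpha>)"
  have s2: "\<sigma>\<^sup>2 = 1 / (2 * \<alpha>)" using \<alpha> by (simp add: \<sigma>_def power_divide)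
  have s0: "\<sigma> > 0" using \<alpha> by (simp add: \<sigma>_def)
  have *: "exp (- \<alpha> * t\<^sup>2) = sqrt (pi / \<alpha>) * normal_density 0 \<sigma> t" for t
    using \<alpha> by (simp add: normal_density_def s2 real_sqrt_divide)
  have 1: "(\<integral>\<^sup>+t. ennreal (exp (- \<alpha> * t\<^sup>2)) \<partial>lborel) = ennreal (sqrt (pi / \<alpha>))"
    unfolding * using \<alpha> s0
    by (subst nn_integral_eq_integral) (auto simp: integral_mult_right_zero)
  have "(\<integral>\<^sup>+\<theta>. ennreal (exp (- \<alpha> * (norm (\<theta>::'a))\<^sup>2)) \<partial>lborel)
      = (\<integral>\<^sup>+\<theta>. (\<Prod>b\<in>Basis. ennreal (exp (- \<alpha> * ((\<theta>::'a) \<bullet> b)\<^sup>2))) \<partial>lborel)"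
  proof (intro nn_integral_cong)
    fix \<theta> :: 'a
    have "(norm \<theta>)\<^sup>2 = (\<Sum>b\<in>Basis. (\<theta> \<bullet> b)\<^sup>2)"
      unfolding power2_norm_eq_inner by (subst euclidean_inner) (simp add: power2_eq_square)
    then have "exp (- \<alpha> * (norm \<theta>)\<^sup>2) = (\<Prod>b\<in>Basis. exp (- \<alpha> * (\<theta> \<bullet> b)\<^sup>2))"
      by (simp add: exp_sum[symmetric] sum_distrib_left sum_negf)
    then show "ennreal (exp (- \<alpha> * (norm \<theta>)\<^sup>2)) = (\<Prod>b\<in>Basis. ennreal (exp (- \<alpha> * (\<theta> \<bullet> b)\<^sup>2)))"
      by (simp add: prod_ennreal)
  qed
  also have "\<dots> = (\<Prod>b\<in>(Basis::'a set). (\<integral>\<^sup>+t. ennreal (exp (- \<alpha> * t\<^sup>2)) \<partial>lborel))"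
    by (rule nn_integral_lborel_prod) auto
  also have "\<dots> = ennreal (sqrt (pi / \<alpha>) ^ DIM('a))"
    unfolding 1 using \<alpha> by (simp add: ennreal_power)
  also have "sqrt (pi / \<alpha>) ^ DIM('a) = (pi / \<alpha>) powr (real DIM('a) / 2)"
    using \<alpha> by (simp add: powr_half_sqrt[symmetric] powr_power)
  finally show "(\<integral>\<^sup>+\<theta>. ennreal (exp (- \<alpha> * (norm (\<theta>::'a))\<^sup>2)) \<partial>lborel) = ennreal ((pi / \<alpha>) powr (real DIM('a) / 2))" .
qed auto

text \<open>Completing the square in \<open>\<theta>\<close>: with
  \<open>\<alpha> = 1 / 2 + \<beta>\<close> the joint exponent is \<open>- \<alpha>\<close> times
  the squared distance from \<open>\<theta>\<close> to \<open>y / (2 * \<alpha>)\<close>, plus a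
  remainder depending on \<open>y\<close> alone.\<close>

lemma gaussian_convolution:
  fixes y :: "'a::euclidean_space"
  assumes \<beta>: "\<beta> > 0"
  shows "has_bochner_integral lborel (\<lambda>\<theta>. exp (- ((norm (y - \<theta>))\<^sup>2 / 2)) * exp (- \<beta> * (norm \<theta>)\<^sup>2))
    ((2 * pi / (1 + 2 * \<beta>)) powr (real DIM('a) / 2) * exp (- \<beta> / (1 + 2 * \<beta>) * (norm y)\<^sup>2))"
proof -
  define \<alpha> where "\<alpha> = 1 / 2 + \<beta>"
  have a: "\<alpha> > 0" using \<beta> by (simp add: \<alpha>_def)
  define v where "v = - (1 / (2 * \<alpha>)) *\<^sub>R y"
  have "has_bochner_integral (distr lborel borel ((+) v)) (\<lambda>\<theta>::'a. exp (- \<alpha> * (norm \<theta>)\<^sup>2))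
    ((pi / \<alpha>) powr (real DIM('a) / 2))"
    unfolding lborel_distr_plus by (rule gaussian_integral[OF a])
  then have "has_bochner_integral lborel (\<lambda>\<theta>::'a. exp (- \<alpha> * (norm (v + \<theta>))\<^sup>2))
    ((pi / \<alpha>) powr (real DIM('a) / 2))"
    by (simp add: has_bochner_integral_iff integrable_distr_eq integral_distr)
  then have "has_bochner_integral lborel
      (\<lambda>\<theta>::'a. exp (- \<alpha> * (norm (v + \<theta>))\<^sup>2) * exp (- \<beta> / (1 + 2 * \<beta>) * (norm y)\<^sup>2))
    ((pi / \<alpha>) powr (real DIM('a) / 2) * exp (- \<beta> / (1 + 2 * \<beta>) * (norm y)\<^sup>2))"
    by (rule has_bochner_integral_mult_left)
  also have "pi / \<alpha> = 2 * pi / (1 + 2 * \<beta>)"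
    using \<beta> by (simp add: \<alpha>_def field_simps)
  also have "(\<lambda>\<theta>::'a. exp (- \<alpha> * (norm (v + \<theta>))\<^sup>2) * exp (- \<beta> / (1 + 2 * \<beta>) * (norm y)\<^sup>2))
      = (\<lambda>\<theta>. exp (- ((norm (y - \<theta>))\<^sup>2 / 2)) * exp (- \<beta> * (norm \<theta>)\<^sup>2))"
  proof
    fix \<theta> :: 'a
    have c: "\<beta> / (1 + 2 * \<beta>) = 1 / 2 - 1 / (4 * \<alpha>)" using \<beta> by (simp add: \<alpha>_def field_simps)
    have "\<alpha> * (norm (v + \<theta>))\<^sup>2 = (y \<bullet> y) / (4 * \<alpha>) - y \<bullet> \<theta> + \<alpha> * (\<theta> \<bullet> \<theta>)"
      unfolding power2_norm_eq_inner v_def using a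
      by (simp add: inner_simps inner_commute[of \<theta> y] field_simps)
    moreover have "(norm (y - \<theta>))\<^sup>2 = y \<bullet> y - 2 * (y \<bullet> \<theta>) + \<theta> \<bullet> \<theta>"
      unfolding power2_norm_eq_inner by (simp add: inner_simps inner_commute[of \<theta> y])
    moreover have "\<alpha> * (\<theta> \<bullet> \<theta>) = (\<theta> \<bullet> \<theta>) / 2 + \<beta> * (norm \<theta>)\<^sup>2"
      unfolding power2_norm_eq_inner by (simp add: \<alpha>_def algebra_simps)
    moreover have "\<beta> / (1 + 2 * \<beta>) * (norm y)\<^sup>2 = (y \<bullet> y) / 2 - (y \<bullet> y) / (4 * \<alpha>)"
      unfolding power2_norm_eq_inner c by (simp add: algebra_simps)
    ultimately have "- \<alpha> * (norm (v + \<theta>))\<^sup>2 + - \<beta> / (1 + 2 * \<beta>) * (norm y)\<^sup>2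
        = - ((norm (y - \<theta>))\<^sup>2 / 2) + - \<beta> * (norm \<theta>)\<^sup>2"
      by (simp add: add_divide_distrib diff_divide_distrib)
    then show "exp (- \<alpha> * (norm (v + \<theta>))\<^sup>2) * exp (- \<beta> / (1 + 2 * \<beta>) * (norm y)\<^sup>2)
      = exp (- ((norm (y - \<theta>))\<^sup>2 / 2)) * exp (- \<beta> * (norm \<theta>)\<^sup>2)"
      unfolding exp_add[symmetric] by simp
  qed
  finally show ?thesis .
qed

text \<open>
  For \<open>\<theta>\<close> normal with covariance \<open>v I\<close>, \<open>v = B exp t / 2\<close>, the variable \<open>y\<close> has covariance \<open>(1 + v) I\<close>;
  \<open>shrinkage B t\<close> is \<open>1 / (2 (1 + v))\<close>, the coefficient of \<open>- \<parallel>y\<parallel>\<^sup>2\<close> in the exponent of its density.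
\<close>

definition shrinkage :: "real \<Rightarrow> real \<Rightarrow> real" where
  "shrinkage B t = 1 / (2 + B * exp t)"

lemma shrinkage_bounds:
  assumes "B > 0" shows "0 < shrinkage B t" "shrinkage B t \<le> 1"
  using assms by (auto simp: shrinkage_def field_simps add_pos_pos intro: add_nonneg_nonneg less_imp_le)

lemma shrinkage_measurable [measurable]: "shrinkage B \<in> borel_measurable borel"
  unfolding shrinkage_def[abs_def] by measurable

definition shrinkage_laplace :: "real measure \<Rightarrow> real \<Rightarrow> real \<Rightarrow> real \<Rightarrow> real" where
  "shrinkage_laplace \<mu> B r u = (\<integral>t. shrinkage B t powr r * exp (- u * shrinkage B t) \<partial>\<mu>)"

text \<open>Each component is a multiple of a centred normal density, to which
  \<open>gaussian_convolution\<close> applies. The integrand is nonnegative and its inner integral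
  is bounded in \<open>t\<close>, so finiteness of \<open>\<mu>\<close> justifies Fubini.\<close>

lemma gaussian_convolution_mixture:
  fixes y :: "'a::euclidean_space" and \<mu> :: "real measure"
  assumes fin: "finite_measure \<mu>" and [measurable_cong, simp]: "sets \<mu> = sets borel" and B: "B > 0"
  defines "q \<equiv> real DIM('a) / 2"
  shows "has_bochner_integral lborel
      (\<lambda>\<theta>. exp (- ((norm (y - \<theta>))\<^sup>2 / 2)) * (\<integral>t. exp (- q * t - (norm \<theta>)\<^sup>2 / B * exp (- t)) \<partial>\<mu>))
      ((2 * pi * B) powr q * shrinkage_laplace \<mu> B q ((norm y)\<^sup>2))"
proof -
  interpret mu: finite_measure \<mu> by fact
  interpret pair_sigma_finite \<mu> "lborel :: 'a measure" ..
  let ?f = "\<lambda>t (\<theta>::'a). exp (- ((norm (y - \<theta>))\<^sup>2 / 2)) * exp (- q * t - (norm \<theta>)\<^sup>2 / B * exp (- t))"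
  let ?g = "\<lambda>t. (2 * pi * B) powr q * (shrinkage B t powr q * exp (- (norm y)\<^sup>2 * shrinkage B t))"
  have inner: "has_bochner_integral lborel (?f t) (?g t)" for t
  proof -
    \<comment> \<open>In terms of the variance \<open>v = B * exp t / 2\<close> of the component,
      this is \<open>1 / (2 * v)\<close>.\<close>
    define \<beta> where "\<beta> = exp (- t) / B"
    have b: "\<beta> > 0" using B by (simp add: \<beta>_def)
    have sh: "1 / (1 + 2 * \<beta>) = B * exp t * shrinkage B t" "\<beta> / (1 + 2 * \<beta>) = shrinkage B t"
    proof -
      have "2 + B * exp t > 0" "exp t * B + 2 > 0" using B by (auto intro!: add_pos_pos)
      then show "1 / (1 + 2 * \<beta>) = B * exp t * shrinkage B t" "\<beta> / (1 + 2 * \<beta>) = shrinkage B t"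
        using B by (auto simp: \<beta>_def shrinkage_def exp_minus field_simps)
    qed
    have "(2 * pi / (1 + 2 * \<beta>)) = (2 * pi * B) * exp t * shrinkage B t"
      using sh(1) by (simp add: divide_inverse mult_ac)
    \<comment> \<open>The factor \<open>exp (q * t)\<close> cancels the weight
      \<open>exp (- q * t)\<close> of the mixture.\<close>
    then have p: "(2 * pi / (1 + 2 * \<beta>)) powr q = (2 * pi * B) powr q * exp (q * t) * shrinkage B t powr q"
      using B shrinkage_bounds[OF B, of t] by (simp add: powr_mult exp_powr_real mult.commute)
    have "has_bochner_integral lborel (\<lambda>\<theta>::'a. exp (- q * t) *
        (exp (- ((norm (y - \<theta>))\<^sup>2 / 2)) * exp (- \<beta> * (norm \<theta>)\<^sup>2)))
        (exp (- q * t) * ((2 * pi / (1 + 2 * \<beta>)) powr q * exp (- \<beta> / (1 + 2 * \<beta>) * (norm y)\<^sup>2)))"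
      unfolding q_def by (rule has_bochner_integral_mult_right[OF gaussian_convolution[OF b]])
    also have "exp (- q * t) * ((2 * pi / (1 + 2 * \<beta>)) powr q * exp (- \<beta> / (1 + 2 * \<beta>) * (norm y)\<^sup>2)) = ?g t"
      unfolding p minus_divide_left[symmetric] sh(2) by (simp add: exp_minus mult_ac)
    also have "(\<lambda>\<theta>::'a. exp (- q * t) * (exp (- ((norm (y - \<theta>))\<^sup>2 / 2)) * exp (- \<beta> * (norm \<theta>)\<^sup>2))) = ?f t"
    proof
      fix \<theta> :: 'a
      have "- q * t - (norm \<theta>)\<^sup>2 / B * exp (- t) = - q * t + - \<beta> * (norm \<theta>)\<^sup>2"
        by (simp add: \<beta>_def)
      then show "exp (- q * t) * (exp (- ((norm (y - \<theta>))\<^sup>2 / 2)) * exp (- \<beta> * (norm \<theta>)\<^sup>2)) = ?f t \<theta>"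
        by (simp only: exp_add mult_ac)
    qed
    finally show ?thesis .
  qed
  have "(\<lambda>t. shrinkage B t powr q * exp (- (norm y)\<^sup>2 * shrinkage B t)) \<in> borel_measurable \<mu>"
    by measurable
  moreover have "shrinkage B t powr q * exp (- (norm y)\<^sup>2 * shrinkage B t) \<le> 1 * 1" for t
    using shrinkage_bounds[OF B, of t] by (intro mult_mono powr_le1) (auto simp: q_def)
  ultimately have g: "integrable \<mu> ?g"
    by (intro integrable_mult_right mu.integrable_const_bound[where B = 1]) auto
  have int: "integrable (\<mu> \<Otimes>\<^sub>M lborel) (case_prod ?f)"
  proof (rule Fubini_integrable)
    have "(\<integral>\<theta>. norm (case (t, \<theta>) of (t, \<theta>) \<Rightarrow> ?f t \<theta>) \<partial>lborel) = ?g t" for t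
      using inner[of t] by (simp add: has_bochner_integral_iff)
    then show "integrable \<mu> (\<lambda>t. \<integral>\<theta>. norm (case (t, \<theta>) of (t, \<theta>) \<Rightarrow> ?f t \<theta>) \<partial>lborel)"
      using g by simp
    show "AE t in \<mu>. integrable lborel (\<lambda>\<theta>. case (t, \<theta>) of (t, \<theta>) \<Rightarrow> ?f t \<theta>)"
      using inner by (simp add: has_bochner_integral_iff)
  qed measurable
  have i: "integrable lborel (\<lambda>\<theta>. \<integral>t. ?f t \<theta> \<partial>\<mu>)"
    using int by (rule integrable_snd)
  have "(\<integral>\<theta>. (\<integral>t. ?f t \<theta> \<partial>\<mu>) \<partial>lborel) = (\<integral>t. (\<integral>\<theta>. ?f t \<theta> \<partial>lborel) \<partial>\<mu>)"
    using int by (rule Fubini_integral)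
  also have "\<dots> = (\<integral>t. ?g t \<partial>\<mu>)"
    using inner by (simp add: has_bochner_integral_iff)
  also have "\<dots> = (2 * pi * B) powr q * shrinkage_laplace \<mu> B q ((norm y)\<^sup>2)"
    unfolding shrinkage_laplace_def by (rule integral_mult_right_zero)
  finally show ?thesis
    using i unfolding integral_mult_right_zero has_bochner_integral_iff by blast
qed

section \<open>Derivatives, positivity and decay of the mixed Laplace transforms\<close>

lemma abs_exp_diff_le: "\<bar>exp a - exp b\<bar> \<le> \<bar>a - b\<bar> * exp (max a b)" for a b :: real
proof -
  have *: "exp b - exp a \<le> (b - a) * exp b" for a b :: real
  proof -
    have "1 + (a - b) \<le> exp (a - b)" by (rule exp_ge_add_one_self)
    then have "(1 + (a - b)) * exp b \<le> exp (a - b) * exp b" by (intro mult_right_mono) auto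
    then show ?thesis by (simp add: exp_diff algebra_simps)
  qed
  show ?thesis using *[of a b] *[of b a] by (cases "a \<le> b") (auto simp: max_def abs_if)
qed

text \<open>The N-th power of \<open>x \<le> N * exp (x / N)\<close>, which follows from
  \<open>1 + h \<le> exp h\<close>. For \<open>N = 0\<close> the bound reads
  \<open>0 ^ 0 = 1\<close>.\<close>

lemma power_mult_exp_minus_le:
  fixes x :: real assumes "x \<ge> 0" shows "x ^ N * exp (- x) \<le> real N ^ N"
proof (cases "N = 0")
  case False
  have "x \<le> real N * exp (x / real N)"
    using exp_ge_add_one_self[of "x / real N"] False by (simp add: field_simps)
  then have "x ^ N \<le> (real N * exp (x / real N)) ^ N"
    using assms by (rule power_mono)
  also have "\<dots> = real N ^ N * exp x"
    using False by (simp add: power_mult_distrib exp_of_nat_mult[symmetric])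
  finally show ?thesis by (simp add: exp_minus divide_simps)
qed (use assms in simp)

context
  fixes \<mu> :: "real measure" and B :: real
  assumes fin: "finite_measure \<mu>" and sets_mu [measurable_cong, simp]: "sets \<mu> = sets borel" and B: "B > 0"
begin

interpretation mu: finite_measure \<mu> by (rule fin)

lemma shrinkage_laplace_integrable:
  assumes r: "r \<ge> 0"
  shows "integrable \<mu> (\<lambda>t. shrinkage B t powr r * exp (- u * shrinkage B t))"
proof (rule mu.integrable_const_bound[where B = "exp \<bar>u\<bar>"])
  have "shrinkage B t powr r * exp (- u * shrinkage B t) \<le> 1 * exp \<bar>u\<bar>" for t
  proof (intro mult_mono powr_le1)
    have "- u * shrinkage B t \<le> \<bar>u\<bar> * 1"
      using shrinkage_bounds[OF B, of t] by (intro mult_mono) auto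
    then show "exp (- u * shrinkage B t) \<le> exp \<bar>u\<bar>" by simp
  qed (use r shrinkage_bounds[OF B, of t] in auto)
  then show "AE t in \<mu>. norm (shrinkage B t powr r * exp (- u * shrinkage B t)) \<le> exp \<bar>u\<bar>"
    by simp
qed measurable

text \<open>Differentiation under the integral, by dominated convergence along sequences. Each
  derivative brings down a factor \<open>- shrinkage B t\<close>, so the family is closed under
  differentiation, with \<open>r\<close> raised by 1.\<close>

lemma DERIV_shrinkage_laplace:
  assumes r: "r \<ge> 0"
  shows "(shrinkage_laplace \<mu> B r has_real_derivative - shrinkage_laplace \<mu> B (r + 1) u) (at u)"
  unfolding DERIV_def tendsto_at_iff_sequentially comp_def
proof (intro allI impI)
  fix X :: "nat \<Rightarrow> real"
  assume X0: "\<forall>i. X i \<in> UNIV - {0}" and X: "X \<longlonglongrightarrow> 0"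
  obtain K where K: "\<And>i. \<bar>X i\<bar> \<le> K"
    using convergent_imp_Bseq[OF convergentI[OF X]] by (auto simp: Bseq_def)
  let ?D = "\<lambda>i t. shrinkage B t powr r * ((exp (- (u + X i) * shrinkage B t) - exp (- u * shrinkage B t)) / X i)"
  have eq: "(shrinkage_laplace \<mu> B r (u + X i) - shrinkage_laplace \<mu> B r u) / X i = (\<integral>t. ?D i t \<partial>\<mu>)" for i
    unfolding shrinkage_laplace_def
      Bochner_Integration.integral_diff[OF shrinkage_laplace_integrable[OF r] shrinkage_laplace_integrable[OF r], symmetric]
      integral_divide_zero[symmetric]
    by (simp add: algebra_simps)
  have "(\<lambda>i. \<integral>t. ?D i t \<partial>\<mu>) \<longlonglongrightarrow> (\<integral>t. shrinkage B t powr r * - (shrinkage B t * exp (- u * shrinkage B t)) \<partial>\<mu>)"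
  proof (rule integral_dominated_convergence)
    show "integrable \<mu> (\<lambda>t. exp (\<bar>u\<bar> + K))" by simp
    show "AE t in \<mu>. (\<lambda>i. ?D i t) \<longlonglongrightarrow> shrinkage B t powr r * - (shrinkage B t * exp (- u * shrinkage B t))"
    proof (intro AE_I2 tendsto_mult tendsto_const)
      fix t
      have "((\<lambda>v. exp (- v * shrinkage B t)) has_real_derivative - (shrinkage B t * exp (- u * shrinkage B t))) (at u)"
        by (auto intro!: derivative_eq_intros)
      then show "(\<lambda>i. (exp (- (u + X i) * shrinkage B t) - exp (- u * shrinkage B t)) / X i)
          \<longlonglongrightarrow> - (shrinkage B t * exp (- u * shrinkage B t))"
        using X0 X unfolding DERIV_def tendsto_at_iff_sequentially comp_def by blast
    qed
    fix i
    \<comment> \<open>As \<open>shrinkage B t \<le> 1\<close>, the exponents differ by at most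
      \<open>\<bar>X i\<bar>\<close>. The estimate \<open>abs_exp_diff_le\<close> then cancels the
      division by \<open>X i\<close> and leaves a bound free of \<open>i\<close> and
      \<open>t\<close>.\<close>
    have "\<bar>?D i t\<bar> \<le> exp (\<bar>u\<bar> + K)" for t
    proof -
      note w = shrinkage_bounds[OF B, of t]
      let ?a = "- (u + X i) * shrinkage B t" and ?b = "- u * shrinkage B t"
      have "?a \<le> (\<bar>u\<bar> + K) * 1" "?b \<le> (\<bar>u\<bar> + K) * 1"
        using w K[of i] by (intro mult_mono; linarith)+
      then have m: "exp (max ?a ?b) \<le> exp (\<bar>u\<bar> + K)" by simp
      have "\<bar>?a - ?b\<bar> \<le> \<bar>X i\<bar> * 1"
      proof -
        have "?a - ?b = - X i * shrinkage B t" by (simp add: algebra_simps)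
        then show ?thesis using w by (simp add: abs_mult mult_left_le)
      qed
      then have "\<bar>?a - ?b\<bar> * exp (max ?a ?b) \<le> \<bar>X i\<bar> * exp (\<bar>u\<bar> + K)"
        using m by (intro mult_mono) auto
      then have "\<bar>exp ?a - exp ?b\<bar> \<le> \<bar>X i\<bar> * exp (\<bar>u\<bar> + K)"
        using abs_exp_diff_le[of ?a ?b] by linarith
      then have "\<bar>(exp ?a - exp ?b) / X i\<bar> \<le> exp (\<bar>u\<bar> + K)"
        using X0 by (simp add: abs_divide field_simps)
      moreover have "shrinkage B t powr r \<le> 1" using w r by (intro powr_le1) auto
      ultimately have "shrinkage B t powr r * \<bar>(exp ?a - exp ?b) / X i\<bar> \<le> 1 * exp (\<bar>u\<bar> + K)"
        by (intro mult_mono) auto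
      then show ?thesis by (simp add: abs_mult)
    qed
    then show "AE t in \<mu>. norm (?D i t) \<le> exp (\<bar>u\<bar> + K)" by simp
  qed measurable
  also have "(\<integral>t. shrinkage B t powr r * - (shrinkage B t * exp (- u * shrinkage B t)) \<partial>\<mu>)
      = - shrinkage_laplace \<mu> B (r + 1) u"
    unfolding shrinkage_laplace_def integral_minus[symmetric]
    using shrinkage_bounds(1)[OF B]
    by (intro Bochner_Integration.integral_cong) (auto simp: powr_add less_imp_le)
  finally show "(\<lambda>i. (shrinkage_laplace \<mu> B r (u + X i) - shrinkage_laplace \<mu> B r u) / X i)
      \<longlonglongrightarrow> - shrinkage_laplace \<mu> B (r + 1) u"
    unfolding eq .
qed

lemma shrinkage_laplace_pos:
  assumes r: "r \<ge> 0" and mu: "emeasure \<mu> (space \<mu>) \<noteq> 0"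
  shows "shrinkage_laplace \<mu> B r u > 0"
proof -
  have "(\<integral>t. 0 \<partial>\<mu>) < shrinkage_laplace \<mu> B r u"
    unfolding shrinkage_laplace_def
    using shrinkage_bounds(1)[OF B, THEN less_imp_neq] mu
    by (intro mu.integral_less_AE_space shrinkage_laplace_integrable r AE_I2 mult_pos_pos) auto
  then show ?thesis by simp
qed

text \<open>Because \<open>shrinkage B t * (2 + B * exp t) = 1\<close>, the factor
  \<open>u ^ N\<close> equals \<open>(u * shrinkage B t) ^ N * (2 + B * exp t) ^ N\<close>. The
  exponential absorbs the first power, and the exponential moments of \<open>\<mu>\<close> control
  the second.\<close>

lemma shrinkage_laplace_decay:
  assumes r: "r \<ge> 0" and u: "u > 0"
    and exp_int: "\<And>j::nat. integrable \<mu> (\<lambda>t. exp (real j * t))"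
  shows "shrinkage_laplace \<mu> B r u * u ^ N \<le> real N ^ N * (\<integral>t. (2 + B * exp t) ^ N \<partial>\<mu>)"
proof -
  have "(2 + B * exp t) ^ N = (\<Sum>k\<le>N. real (N choose k) * B ^ k * 2 ^ (N - k) * exp (real k * t))" for t
    unfolding add.commute[of 2] binomial_ring power_mult_distrib exp_of_nat_mult by (simp add: mult_ac)
  then have int: "integrable \<mu> (\<lambda>t. (2 + B * exp t) ^ N)"
    using exp_int by simp
  have "shrinkage_laplace \<mu> B r u * u ^ N = (\<integral>t. shrinkage B t powr r * exp (- u * shrinkage B t) * u ^ N \<partial>\<mu>)"
    unfolding shrinkage_laplace_def by simp
  also have "\<dots> \<le> (\<integral>t. real N ^ N * (2 + B * exp t) ^ N \<partial>\<mu>)"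
  proof (intro integral_mono)
    fix t
    note w = shrinkage_bounds[OF B, of t]
    have "(u * shrinkage B t) ^ N * exp (- u * shrinkage B t) \<le> real N ^ N"
      using power_mult_exp_minus_le[of "u * shrinkage B t" N] u w by simp
    moreover have "shrinkage B t powr r \<le> 1" using w r by (intro powr_le1) auto
    ultimately have "shrinkage B t powr r * ((u * shrinkage B t) ^ N * exp (- u * shrinkage B t)) \<le> 1 * real N ^ N"
      using u w by (intro mult_mono) auto
    then have "shrinkage B t powr r * ((u * shrinkage B t) ^ N * exp (- u * shrinkage B t)) * (2 + B * exp t) ^ N
        \<le> real N ^ N * (2 + B * exp t) ^ N"
      using B by (intro mult_right_mono) (auto intro!: zero_le_power add_nonneg_nonneg)
    moreover have "shrinkage B t * (2 + B * exp t) = 1"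
      using w by (simp add: shrinkage_def)
    then have "shrinkage B t ^ N * (2 + B * exp t) ^ N = 1" by (simp flip: power_mult_distrib)
    moreover have "shrinkage B t powr r * ((u * shrinkage B t) ^ N * exp (- u * shrinkage B t)) * (2 + B * exp t) ^ N
        = shrinkage B t powr r * exp (- u * shrinkage B t) * u ^ N * (shrinkage B t ^ N * (2 + B * exp t) ^ N)"
      by (simp add: power_mult_distrib mult_ac)
    ultimately show "shrinkage B t powr r * exp (- u * shrinkage B t) * u ^ N \<le> real N ^ N * (2 + B * exp t) ^ N"
      by (simp only: mult_1_right)
  qed (use int shrinkage_laplace_integrable[OF r] in auto)
  finally show ?thesis by simp
qed

end

section \<open>Radial superharmonic functions\<close>

text \<open>
  Here \<open>f(y) = H(\<parallel>y\<parallel>\<^sup>2)\<close>, so that \<open>2 (p H1 + 2 u H2)\<close> at \<open>u = \<parallel>y\<parallel>\<^sup>2\<close> is the Laplacian of \<open>f\<close>.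
  Up to a constant, \<open>u powr (p / 2) * H1 u\<close> is the flux of the gradient of \<open>f\<close> through the sphere of radius \<open>sqrt u\<close>;
  superharmonicity makes it nonincreasing, which bounds \<open>H1\<close> from above by a negative multiple of \<open>u powr (- p / 2)\<close>.
\<close>

lemma superharmonic_profile_decay:
  fixes H H1 H2 :: "real \<Rightarrow> real" and p :: nat
  assumes p: "p \<ge> 3"
    and H: "\<And>u. u > 0 \<Longrightarrow> (H has_real_derivative H1 u) (at u)"
    and H1: "\<And>u. u > 0 \<Longrightarrow> (H1 has_real_derivative H2 u) (at u)"
    and pos: "\<And>u. u > 0 \<Longrightarrow> H u > 0"
    and K: "\<And>u. u > 0 \<Longrightarrow> (H u)\<^sup>2 * u ^ (p - 1) \<le> K"
  shows "\<exists>u>0. p * H1 u + 2 * u * H2 u > 0"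
proof (rule ccontr)
  assume "\<not> ?thesis"
  then have le: "p * H1 u + 2 * u * H2 u \<le> 0" if "u > 0" for u
    using that by (meson not_less)
  \<comment> \<open>A lower bound by the fundamental solution contradicts \<open>K\<close>: its
    square times \<open>u ^ (p - 1)\<close> is \<open>A\<^sup>2 * u\<close>, and \<open>u\<close> is
    taken so large that this is at least \<open>\<bar>K\<bar> + 1\<close>.\<close>
  have no_lower: False if "A > 0" "b > 0" "\<And>u. u \<ge> b \<Longrightarrow> H u \<ge> A * u powr (1 - p / 2)" for A b
  proof -
    define u where "u = max b ((\<bar>K\<bar> + 1) / A\<^sup>2)"
    have u: "u > 0" "u \<ge> b" "u \<ge> (\<bar>K\<bar> + 1) / A\<^sup>2" using that(2) by (auto simp: u_def)
    have "(A * u powr (1 - p / 2))\<^sup>2 \<le> (H u)\<^sup>2"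
      using that(1) that(3)[OF u(2)] by (intro power_mono) auto
    then have "(A * u powr (1 - p / 2))\<^sup>2 * u ^ (p - 1) \<le> (H u)\<^sup>2 * u ^ (p - 1)"
      using u by (intro mult_right_mono) auto
    also have "\<dots> \<le> K" using u(1) by (rule K)
    also have "(A * u powr (1 - p / 2))\<^sup>2 * u ^ (p - 1) = A\<^sup>2 * (u powr (2 * (1 - p / 2)) * u powr (p - 1))"
      using u(1) p by (simp add: power_mult_distrib powr_realpow[symmetric] power2_eq_square powr_add[symmetric])
    also have "\<dots> = A\<^sup>2 * u"
      using u(1) p by (simp add: powr_add[symmetric] of_nat_diff)
    finally have "A\<^sup>2 * u \<le> K" .
    moreover have "\<bar>K\<bar> + 1 \<le> A\<^sup>2 * u"
      using u(3) that(1) by (simp add: field_simps)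
    ultimately show False by linarith
  qed
  \<comment> \<open>Otherwise \<open>H\<close> is nondecreasing and stays above \<open>H 1\<close>
    on \<open>{1..}\<close>, which is even stronger than the bound excluded by
    \<open>no_lower\<close>.\<close>
  have "\<exists>u0>0. H1 u0 < 0"
  proof (rule ccontr)
    assume "\<not> ?thesis"
    then have ge: "H1 u \<ge> 0" if "u > 0" for u using that by (meson not_less)
    show False
    proof (rule no_lower)
      show "H 1 > 0" by (rule pos) simp
      fix u :: real assume u: "u \<ge> 1"
      have "H 1 \<le> H u"
        using u ge H by (intro DERIV_nonneg_imp_nondecreasing[of 1 u H]) (auto intro: less_le_trans[OF zero_less_one])
      moreover have "u powr (1 - p / 2) \<le> u powr 0" using u p by (intro powr_mono) auto
      then have "u powr (1 - p / 2) \<le> 1" using u by simp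
      then have "H 1 * u powr (1 - p / 2) \<le> H 1"
        using pos[of 1] by simp
      ultimately show "H u \<ge> H 1 * u powr (1 - p / 2)" by linarith
    qed simp
  qed
  then obtain u0 where u0: "u0 > 0" "H1 u0 < 0" by blast
  define \<phi> where "\<phi> = (\<lambda>u. u powr (p / 2) * H1 u)"
  define a where "a = - \<phi> u0"
  have a: "a > 0" using u0 by (simp add: a_def \<phi>_def mult_pos_neg)
  \<comment> \<open>The derivative of the flux is the nonnegative factor
    \<open>v powr (p / 2 - 1) / 2\<close> times the expression that \<open>le\<close> bounds by
    0.\<close>
  have \<phi>: "\<phi> u \<le> - a" if "u \<ge> u0" for u
    unfolding a_def minus_minus
  proof (rule DERIV_nonpos_imp_nonincreasing[OF that])
    fix v assume "u0 \<le> v" "v \<le> u"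
    then have v: "v > 0" using u0 by linarith
    have d: "(\<phi> has_real_derivative (p / 2 * v powr (p / 2 - 1) * H1 v + v powr (p / 2) * H2 v)) (at v)"
      unfolding \<phi>_def using v by (auto intro!: derivative_eq_intros H1)
    have "v powr (p / 2) = v powr (p / 2 - 1) * v"
      using v by (simp add: powr_diff)
    then have "p / 2 * v powr (p / 2 - 1) * H1 v + v powr (p / 2) * H2 v
        = v powr (p / 2 - 1) / 2 * (p * H1 v + 2 * v * H2 v)"
      by (simp add: algebra_simps)
    also have "\<dots> \<le> 0"
      using le[OF v] by (intro mult_nonneg_nonpos) auto
    finally show "\<exists>y. (\<phi> has_real_derivative y) (at v) \<and> y \<le> 0"
      using d by (intro exI conjI)
  qed
  \<comment> \<open>With this value \<open>A * u powr (1 - p / 2)\<close> has derivative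
    \<open>- a * u powr (- p / 2)\<close>, the upper bound for \<open>H1\<close> coming from the
    flux. Here \<open>p \<ge> 3\<close> makes \<open>A\<close> positive.\<close>
  define A where "A = a / (p / 2 - 1)"
  have A: "A > 0" using a p by (simp add: A_def)
  have Aa: "A * (1 - p / 2) = - a" using p by (simp add: A_def field_simps)
  define \<psi> where "\<psi> = (\<lambda>u. H u - A * u powr (1 - p / 2))"
  have \<psi>: "\<psi> v \<le> \<psi> u" if "u \<ge> u0" "u \<le> v" for u v
  proof (rule DERIV_nonpos_imp_nonincreasing[OF that(2)])
    fix x assume "u \<le> x" "x \<le> v"
    then have x: "x > 0" "x \<ge> u0" using u0 that by linarith+
    have d: "(\<psi> has_real_derivative (H1 x - A * ((1 - p / 2) * x powr (1 - p / 2 - 1)))) (at x)"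
      unfolding \<psi>_def using x by (auto intro!: derivative_eq_intros H)
    have "H1 x - A * ((1 - p / 2) * x powr (1 - p / 2 - 1)) = H1 x + a * x powr (- (p / 2))"
      using Aa by (simp add: mult.assoc[symmetric])
    also have "\<dots> = (\<phi> x + a) * x powr (- (p / 2))"
      using x by (simp add: \<phi>_def algebra_simps powr_minus)
    also have "\<dots> \<le> 0"
      using \<phi>[OF x(2)] by (intro mult_nonpos_nonneg) auto
    finally show "\<exists>y. (\<psi> has_real_derivative y) (at x) \<and> y \<le> 0"
      using d by (intro exI conjI)
  qed
  show False
  proof (rule no_lower[OF A u0(1)])
    fix u assume u: "u \<ge> u0"
    \<comment> \<open>Positivity of \<open>H\<close> bounds \<open>\<psi> v\<close> from below by a
      quantity tending to 0. Since \<open>\<psi>\<close> is nonincreasing, \<open>\<psi> u\<close>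
      is at least that limit.\<close>
    have "((\<lambda>v. - (A * v powr (1 - p / 2))) \<longlongrightarrow> - (A * 0)) at_top"
      using p by (intro tendsto_intros tendsto_neg_powr filterlim_ident) auto
    moreover have "eventually (\<lambda>v. - (A * v powr (1 - p / 2)) \<le> \<psi> u) at_top"
      using eventually_ge_at_top[of u]
    proof eventually_elim
      case (elim v)
      then have "H v > 0" using u u0 by (intro pos) linarith
      then show ?case using \<psi>[OF u elim] by (simp add: \<psi>_def)
    qed
    ultimately have "- (A * 0) \<le> \<psi> u"
      by (rule tendsto_upperbound) simp
    then show "H u \<ge> A * u powr (1 - p / 2)" by (simp add: \<psi>_def)
  qed
qed

section \<open>The Laplacian of a radial function in terms of its profile\<close>

lemma norm_sq_line:
  fixes y :: "real ^ 'p"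
  shows "(norm (y + t *\<^sub>R axis i 1))\<^sup>2 = (norm y)\<^sup>2 + 2 * t * (y $ i) + t\<^sup>2"
  unfolding power2_norm_eq_inner
  by (simp add: inner_add_left inner_add_right inner_axis inner_axis' power2_eq_square) (simp add: distrib_left)

lemma laplacian_radial:
  fixes y :: "real ^ 'p"
  assumes y: "y \<noteq> 0"
    and H: "\<And>u. u > 0 \<Longrightarrow> (H has_real_derivative H1 u) (at u)"
    and H1: "\<And>u. u > 0 \<Longrightarrow> (H1 has_real_derivative H2 u) (at u)"
  shows "laplacian (\<lambda>y :: real ^ 'p. H ((norm y)\<^sup>2)) y
    = 2 * real CARD('p) * H1 ((norm y)\<^sup>2) + 4 * (norm y)\<^sup>2 * H2 ((norm y)\<^sup>2)"
proof -
  let ?f = "\<lambda>y :: real ^ 'p. H ((norm y)\<^sup>2)"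
  have 1: "partial_deriv i ?f z = 2 * (z $ i) * H1 ((norm z)\<^sup>2)" if "z \<noteq> 0" for i z
    unfolding partial_deriv_def norm_sq_line
  proof (rule DERIV_imp_deriv)
    have "((\<lambda>t. (norm z)\<^sup>2 + 2 * t * (z $ i) + t\<^sup>2) has_real_derivative 2 * (z $ i)) (at 0)"
      by (auto intro!: derivative_eq_intros)
    moreover have "(H has_real_derivative H1 ((norm z)\<^sup>2)) (at ((norm z)\<^sup>2 + 2 * 0 * (z $ i) + 0\<^sup>2))"
      using H[of "(norm z)\<^sup>2"] that by simp
    ultimately show "((\<lambda>t. H ((norm z)\<^sup>2 + 2 * t * (z $ i) + t\<^sup>2)) has_real_derivative 2 * (z $ i) * H1 ((norm z)\<^sup>2)) (at 0)"
      using DERIV_chain2 by (fastforce simp: mult.commute)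
  qed
  have 2: "partial_deriv i (partial_deriv i ?f) y = 2 * H1 ((norm y)\<^sup>2) + 4 * (y $ i)\<^sup>2 * H2 ((norm y)\<^sup>2)" for i
  proof -
    let ?z = "\<lambda>t. y + t *\<^sub>R axis i 1"
    \<comment> \<open>Formula 1 is available only off the origin. Near \<open>t = 0\<close> the line
      through \<open>y\<close> avoids the origin, and the second derivative depends only on such
      \<open>t\<close>.\<close>
    have "isCont ?z 0" by (intro continuous_intros)
    then have "eventually (\<lambda>t. ?z t \<noteq> 0) (nhds 0)"
      using y by (auto simp: isCont_def eventually_nhds_conv_at intro!: tendsto_imp_eventually_ne)
    then have ev: "eventually (\<lambda>t. partial_deriv i ?f (?z t)
        = 2 * (y $ i + t) * H1 ((norm y)\<^sup>2 + 2 * t * (y $ i) + t\<^sup>2)) (nhds 0)"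
      by eventually_elim (simp add: 1 norm_sq_line)
    have "((\<lambda>t. (norm y)\<^sup>2 + 2 * t * (y $ i) + t\<^sup>2) has_real_derivative 2 * (y $ i)) (at 0)"
      by (auto intro!: derivative_eq_intros)
    moreover have "(H1 has_real_derivative H2 ((norm y)\<^sup>2)) (at ((norm y)\<^sup>2 + 2 * 0 * (y $ i) + 0\<^sup>2))"
      using H1[of "(norm y)\<^sup>2"] y by simp
    ultimately have "((\<lambda>t. H1 ((norm y)\<^sup>2 + 2 * t * (y $ i) + t\<^sup>2)) has_real_derivative H2 ((norm y)\<^sup>2) * (2 * (y $ i))) (at 0)"
      by (rule DERIV_chain2[rotated])
    then have "((\<lambda>t. 2 * (y $ i + t) * H1 ((norm y)\<^sup>2 + 2 * t * (y $ i) + t\<^sup>2)) has_real_derivative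
        2 * H1 ((norm y)\<^sup>2) + 4 * (y $ i)\<^sup>2 * H2 ((norm y)\<^sup>2)) (at 0)"
      by (auto intro!: derivative_eq_intros simp: power2_eq_square)
    then show ?thesis
      unfolding partial_deriv_def[of i "partial_deriv i ?f"] using deriv_cong_ev[OF ev refl]
      by (simp add: DERIV_imp_deriv)
  qed
  have "(\<Sum>i\<in>UNIV. (y $ i)\<^sup>2) = (norm y)\<^sup>2"
    unfolding power2_norm_eq_inner inner_vec_def by (simp add: power2_eq_square)
  then show ?thesis
    unfolding laplacian_def 2 by (simp add: sum.distrib sum_distrib_left[symmetric] sum_distrib_right[symmetric])
qed

section \<open>The marginal density of the network prior\<close>

lemma bnn_B_pos:
  assumes "\<And>l. l \<in> {1..d} \<Longrightarrow> \<sigma> l > 0" "x \<noteq> 0"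
  shows "bnn_B d \<sigma> x > 0"
proof -
  have "(\<Prod>l\<in>{1..d}. (\<sigma> l)\<^sup>2) > 0"
    using assms(1) by (intro prod_pos zero_less_power)
  then show ?thesis using assms(2) by (simp add: bnn_B_def)
qed

text \<open>Apply \<open>meijer_G_eq_integral\<close> with \<open>a l = k l / 2\<close> and
  \<open>q = p / 2\<close>, as \<open>(k l - p) / 2 = a l - q\<close>. The remaining factors are
  positive because \<open>1 \<le> k l \<le> n l\<close>, and they are collected in
  \<open>C\<close>.\<close>

lemma bnn_prior_eq_mixture:
  fixes d :: nat and \<sigma> :: "nat \<Rightarrow> real" and x :: "real ^ 'q"
  defines "B \<equiv> bnn_B d \<sigma> x" and "p \<equiv> real CARD('p)"
  assumes B: "B > 0"
  shows "\<exists>C. (\<forall>k\<in>(\<Pi>\<^sub>E l\<in>{1..d-1}. {1..n l}). C k > 0) \<and>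
    (\<forall>\<theta> :: real ^ 'p. \<theta> \<noteq> 0 \<longrightarrow> bnn_prior d n \<sigma> x \<theta> =
      (\<Sum>k\<in>(\<Pi>\<^sub>E l\<in>{1..d-1}. {1..n l}). C k *
        (\<integral>t. exp (- (p / 2) * t - (norm \<theta>)\<^sup>2 / B * exp (- t)) \<partial>log_gamma_sum {1..d-1} (\<lambda>l. real (k l) / 2))))"
proof (intro exI conjI ballI allI impI)
  let ?K = "\<Pi>\<^sub>E l\<in>{1..d-1}. {1..n l}"
  let ?C = "\<lambda>k. 1 / 2 ^ (\<Sum>l\<in>{1..d-1}. n l) * ((\<Prod>l\<in>{1..d-1}. real (n l choose k l)) *
      ((\<Prod>l\<in>{1..d-1}. inverse (Gamma (real (k l) / 2))) / (pi * B) powr (p / 2)))"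
  have pos: "real (k l) / 2 > 0" if "k \<in> ?K" "l \<in> {1..d-1}" for k l
    using PiE_mem[OF that] by simp
  show "?C k > 0" if k: "k \<in> ?K" for k
  proof -
    have "Gamma (real (k l) / 2) > 0" if "l \<in> {1..d-1}" for l
      using pos[OF k that] by (rule Gamma_real_pos)
    moreover have "k l \<le> n l" if "l \<in> {1..d-1}" for l
      using PiE_mem[OF k that] by simp
    ultimately show ?thesis
      using B by (intro mult_pos_pos divide_pos_pos prod_pos) auto
  qed
  fix \<theta> :: "real ^ 'p" assume \<theta>: "\<theta> \<noteq> 0"
  let ?I = "\<lambda>k. \<integral>t. exp (- (p / 2) * t - (norm \<theta>)\<^sup>2 / B * exp (- t)) \<partial>log_gamma_sum {1..d-1} (\<lambda>l. real (k l) / 2)"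
  let ?R = "\<lambda>k. Re (meijer_G (0 # map (\<lambda>l. (real (k l) - p) / 2) [1..<d]) ((norm \<theta>)\<^sup>2 / B))"
  have d: "{1..d-1} = {1..<d}" by auto
  have R: "?R k = ?I k" if "k \<in> ?K" for k
  proof -
    have "(norm \<theta>)\<^sup>2 / B > 0" using B \<theta> by simp
    moreover have "\<And>l. l \<in> {1..<d} \<Longrightarrow> real (k l) / 2 > 0"
      using pos[OF that] unfolding d by blast
    ultimately show ?thesis
      unfolding diff_divide_distrib d by (subst meijer_G_eq_integral) (assumption | simp)+
  qed
  have distrib: "a * (\<Sum>k\<in>A. b k * c k * f k) = (\<Sum>k\<in>A. a * (b k * c k) * g k)"
    if "\<And>k. k \<in> A \<Longrightarrow> f k = g k" for a :: real and b c f g :: "'a \<Rightarrow> real" and A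
    using that by (simp add: sum_distrib_left mult.assoc)
  show "bnn_prior d n \<sigma> x \<theta> = (\<Sum>k\<in>?K. ?C k * ?I k)"
    unfolding bnn_prior_def Let_def if_not_P[OF \<theta>] B_def[symmetric] p_def[symmetric]
    by (rule distrib) (rule R)
qed

text \<open>Linearity over the finite sum reduces this to
  \<open>gaussian_convolution_mixture\<close> for each tuple. The normal constant \<open>c\<close>
  and the convolution constant \<open>s\<close> go into the coefficients.\<close>

lemma gaussian_marginal_bnn_prior:
  fixes d :: nat and \<sigma> :: "nat \<Rightarrow> real" and x :: "real ^ 'q"
  defines "B \<equiv> bnn_B d \<sigma> x" and "q \<equiv> real CARD('p) / 2"
  assumes B: "B > 0"
  shows "\<exists>D. (\<forall>k\<in>(\<Pi>\<^sub>E l\<in>{1..d-1}. {1..n l}). D k > 0) \<and>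
    (\<forall>y :: real ^ 'p. gaussian_marginal (bnn_prior d n \<sigma> x) y
      = (\<Sum>k\<in>(\<Pi>\<^sub>E l\<in>{1..d-1}. {1..n l}). D k *
          shrinkage_laplace (log_gamma_sum {1..d-1} (\<lambda>l. real (k l) / 2)) B q ((norm y)\<^sup>2)))"
proof -
  define K where "K = (\<Pi>\<^sub>E l\<in>{1..d-1}. {1..n l})"
  define \<mu> :: "(nat \<Rightarrow> nat) \<Rightarrow> real measure"
    where "\<mu> = (\<lambda>k. log_gamma_sum {1..d-1} (\<lambda>l. real (k l) / 2))"
  define I where "I = (\<lambda>k (\<theta> :: real ^ 'p). \<integral>t. exp (- q * t - (norm \<theta>)\<^sup>2 / B * exp (- t)) \<partial>\<mu> k)"
  obtain C where C: "\<And>k. k \<in> K \<Longrightarrow> C k > 0"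
    and prior: "\<And>\<theta> :: real ^ 'p. \<theta> \<noteq> 0 \<Longrightarrow> bnn_prior d n \<sigma> x \<theta> = (\<Sum>k\<in>K. C k * I k \<theta>)"
    using bnn_prior_eq_mixture[OF B[unfolded B_def], of n, where 'p = 'p]
    unfolding K_def I_def \<mu>_def q_def B_def by blast
  define c where "c = (2 * pi) powr (- q)"
  define s where "s = (2 * pi * B) powr q"
  have "gaussian_marginal (bnn_prior d n \<sigma> x) y
      = (\<Sum>k\<in>K. c * (C k * s) * shrinkage_laplace (\<mu> k) B q ((norm y)\<^sup>2))" for y :: "real ^ 'p"
  proof -
    define e where "e = (\<lambda>\<theta>. exp (- ((norm (y - \<theta>))\<^sup>2 / 2)))"
    define G where "G = (\<lambda>\<theta>. c * (\<Sum>k\<in>K. C k * (e \<theta> * I k \<theta>)))"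
    have comp: "has_bochner_integral lborel (\<lambda>\<theta>. e \<theta> * I k \<theta>)
        (s * shrinkage_laplace (\<mu> k) B q ((norm y)\<^sup>2))" if "k \<in> K" for k
    proof -
      have "real (k l) / 2 > 0" if "l \<in> {1..d-1}" for l
        using PiE_mem[OF \<open>k \<in> K\<close>[unfolded K_def] that] by simp
      then have "finite_measure (\<mu> k)"
        unfolding \<mu>_def by (intro finite_log_gamma_sum) auto
      moreover have "sets (\<mu> k) = sets borel" by (simp add: \<mu>_def)
      ultimately show ?thesis
        using gaussian_convolution_mixture[of "\<mu> k" B y] B
        unfolding e_def I_def s_def q_def by simp
    qed
    have "has_bochner_integral lborel G
        (c * (\<Sum>k\<in>K. C k * (s * shrinkage_laplace (\<mu> k) B q ((norm y)\<^sup>2))))"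
      unfolding G_def by (intro has_bochner_integral_mult_right has_bochner_integral_sum comp)
    then have G: "G \<in> borel_measurable lborel"
      and E: "integral\<^sup>L lborel G = (\<Sum>k\<in>K. c * (C k * s) * shrinkage_laplace (\<mu> k) B q ((norm y)\<^sup>2))"
      by (auto simp: has_bochner_integral_iff sum_distrib_left mult.assoc)
    let ?F = "\<lambda>\<theta>. c * e \<theta> * bnn_prior d n \<sigma> x \<theta>"
    have F: "?F = (\<lambda>\<theta>. if \<theta> = 0 then 0 else G \<theta>)"
    proof
      fix \<theta> :: "real ^ 'p"
      show "?F \<theta> = (if \<theta> = 0 then 0 else G \<theta>)"
      proof (cases "\<theta> = 0")
        case False
        then show ?thesis
          by (simp add: prior G_def sum_distrib_left mult.assoc mult.left_commute[of "e \<theta>"])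
      qed (simp add: bnn_prior_def)
    qed
    have "(\<integral>\<theta>. ?F \<theta> \<partial>lborel) = integral\<^sup>L lborel G"
    proof (rule integral_cong_AE)
      show "?F \<in> borel_measurable lborel"
        unfolding F using G by (intro measurable_If) auto
      show "AE \<theta> in lborel. ?F \<theta> = G \<theta>"
        using AE_lborel_singleton[of "0 :: real ^ 'p"]
        by eventually_elim (simp only: fun_cong[OF F] if_False)
    qed (rule G)
    then show ?thesis
      unfolding gaussian_marginal_def E by (simp only: c_def e_def q_def)
  qed
  moreover have "c * (C k * s) > 0" if "k \<in> K" for k
    using C[OF that] B by (simp add: c_def s_def)
  ultimately show ?thesis
    unfolding K_def \<mu>_def by (intro exI[of _ "\<lambda>k. c * (C k * s)"]) blast
qed

theorem theorem2p4:
  fixes d :: nat and n :: "nat \<Rightarrow> nat" and \<sigma> :: "nat \<Rightarrow> real"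
    and x :: "real ^ 'q" and m :: "real ^ 'p \<Rightarrow> real"
  assumes "CARD('p) \<ge> 3"
    and "d \<ge> 2"
    and "\<And>l. l \<in> {1..d-1} \<Longrightarrow> n l \<ge> 1"
    and "\<And>l. l \<in> {1..d} \<Longrightarrow> \<sigma> l > 0"
    and "x \<noteq> 0"
    and "m = gaussian_marginal (bnn_prior d n \<sigma> x)"
  shows "\<not> (\<forall>y. laplacian (\<lambda>y. sqrt (m y)) y \<le> 0)"
proof -
  define q where "q = real CARD('p) / 2"
  have q: "q \<ge> 0" by (simp add: q_def)
  define B where "B = bnn_B d \<sigma> x"
  define K where "K = (\<Pi>\<^sub>E l\<in>{1..d-1}. {1..n l})"
  have B: "B > 0" unfolding B_def using assms(4,5) by (rule bnn_B_pos)
  obtain D where D: "\<And>k. k \<in> K \<Longrightarrow> D k > 0"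
    and marginal: "\<And>y :: real ^ 'p. gaussian_marginal (bnn_prior d n \<sigma> x) y
      = (\<Sum>k\<in>K. D k * shrinkage_laplace (log_gamma_sum {1..d-1} (\<lambda>l. real (k l) / 2)) B q ((norm y)\<^sup>2))"
    using gaussian_marginal_bnn_prior[OF B[unfolded B_def], of n, where 'p = 'p]
    unfolding K_def q_def B_def by blast
  define \<mu> :: "(nat \<Rightarrow> nat) \<Rightarrow> real measure"
    where "\<mu> = (\<lambda>k. log_gamma_sum {1..d-1} (\<lambda>l. real (k l) / 2))"
  have finK: "finite K" unfolding K_def by (intro finite_PiE) auto
  \<comment> \<open>All widths are at least 1, so at least one mixture term is present.\<close>
  have neK: "K \<noteq> {}" using assms(3) by (force simp: K_def PiE_eq_empty_iff)
  have kpos: "real (k l) / 2 > 0" if "k \<in> K" "l \<in> {1..d-1}" for k l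
    using PiE_mem[OF that(1)[unfolded K_def] that(2)] by simp
  have fin: "finite_measure (\<mu> k)" if "k \<in> K" for k
    unfolding \<mu>_def using kpos[OF that] by (intro finite_log_gamma_sum) auto
  have sets: "sets (\<mu> k) = sets borel" for k by (simp add: \<mu>_def)
  have expint: "integrable (\<mu> k) (\<lambda>t. exp (real j * t))" if "k \<in> K" for k and j :: nat
    unfolding \<mu>_def
  proof (rule log_gamma_sum_exp_real)
    fix l assume "l \<in> {1..d-1}"
    from kpos[OF that this] show "real j > - (real (k l) / 2)"
      using of_nat_0_le_iff[of j] by linarith
  qed simp
  \<comment> \<open>The total mass is the exponential moment at 0, a product of the nonzero values
    \<open>Gamma (k l / 2)\<close>.\<close>
  have nz: "emeasure (\<mu> k) (space (\<mu> k)) \<noteq> 0" if "k \<in> K" for k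
  proof
    assume "emeasure (\<mu> k) (space (\<mu> k)) = 0"
    then have "(\<integral>t. exp (0 * complex_of_real t) \<partial>\<mu> k) = 0"
      by (simp add: measure_def)
    moreover have "(\<integral>t. exp (0 * complex_of_real t) \<partial>\<mu> k)
        = (\<Prod>l\<in>{1..d-1}. Gamma (of_real (real (k l) / 2) + 0))"
      unfolding \<mu>_def using kpos[OF that] by (intro log_gamma_sum_exp(2)) auto
    moreover have "Gamma (complex_of_real (real (k l) / 2) + 0) \<noteq> 0" if "l \<in> {1..d-1}" for l
      using Gamma_real_pos[OF kpos[OF \<open>k \<in> K\<close> that]]
      unfolding add_0_right Gamma_complex_of_real by simp
    ultimately show False by (simp add: prod_zero_iff)
  qed
  \<comment> \<open>The marginal is \<open>L q\<close> at the squared norm; the index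
    \<open>r\<close> is kept free because differentiation raises it.\<close>
  define L where "L = (\<lambda>r u. \<Sum>k\<in>K. D k * shrinkage_laplace (\<mu> k) B r u)"
  have m: "m y = L q ((norm y)\<^sup>2)" for y
    unfolding assms(6) marginal L_def \<mu>_def ..
  have L_deriv: "(L r has_real_derivative - L (r + 1) u) (at u)" if "r \<ge> 0" for r u
  proof -
    have "(L r has_real_derivative (\<Sum>k\<in>K. D k * - shrinkage_laplace (\<mu> k) B (r + 1) u)) (at u)"
      unfolding L_def
      by (intro DERIV_sum DERIV_cmult DERIV_shrinkage_laplace fin sets B that)
    then show ?thesis by (simp add: L_def sum_negf)
  qed
  have L_pos: "L r u > 0" if "r \<ge> 0" for r u
    unfolding L_def using finK neK
    by (intro sum_pos mult_pos_pos D shrinkage_laplace_pos fin sets B nz that)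
  \<comment> \<open>As \<open>(H u)\<^sup>2 = L q u\<close>, this is exactly the power required in
    \<open>superharmonic_profile_decay\<close>.\<close>
  define N where "N = CARD('p) - 1"
  define M where "M = (\<Sum>k\<in>K. D k * (real N ^ N * (\<integral>t. (2 + B * exp t) ^ N \<partial>\<mu> k)))"
  have L_decay: "L q u * u ^ N \<le> M" if "u > 0" for u
    unfolding L_def M_def sum_distrib_right mult.assoc
    by (intro sum_mono mult_left_mono shrinkage_laplace_decay fin sets B q that expint less_imp_le[OF D])
  define H where "H = (\<lambda>u. sqrt (L q u))"
  \<comment> \<open>The first two derivatives of \<open>H\<close> by the chain and quotient rules;
    \<open>H1\<close> recurs in \<open>H2\<close> because \<open>2 * sqrt (L q u)\<close> has
    derivative \<open>2 * H1 u\<close>.\<close>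
  define H1 where "H1 = (\<lambda>u. - L (q + 1) u / (2 * sqrt (L q u)))"
  define H2 where "H2 = (\<lambda>u. (L (q + 2) u * (2 * sqrt (L q u)) - (- L (q + 1) u) * (2 * H1 u))
      / ((2 * sqrt (L q u)) * (2 * sqrt (L q u))))"
  have H: "(H has_real_derivative H1 u) (at u)" for u
    unfolding H_def H1_def using L_pos[of q u] L_deriv[of q u] q
    by (auto intro!: derivative_eq_intros simp: field_simps)
  have H1: "(H1 has_real_derivative H2 u) (at u)" for u
  proof -
    have "((\<lambda>u. - L (q + 1) u) has_real_derivative L (q + 2) u) (at u)"
      using DERIV_minus[OF L_deriv[of "q + 1" u]] q by (simp add: add.assoc)
    moreover have "((\<lambda>u. 2 * sqrt (L q u)) has_real_derivative 2 * H1 u) (at u)"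
      using DERIV_cmult[OF H, of 2 u] unfolding H_def .
    moreover have "2 * sqrt (L q u) \<noteq> 0" using L_pos[of q u] q by simp
    ultimately show ?thesis unfolding H2_def unfolding H1_def[abs_def] by (rule DERIV_divide)
  qed
  have "\<exists>u>0. real CARD('p) * H1 u + 2 * u * H2 u > 0"
  proof (rule superharmonic_profile_decay)
    show "H u > 0" for u unfolding H_def using L_pos[OF q] by simp
    show "(H u)\<^sup>2 * u ^ (CARD('p) - 1) \<le> M" if "u > 0" for u
      unfolding H_def using L_decay[OF that] less_imp_le[OF L_pos[OF q]] by (simp add: N_def)
  qed (use assms(1) H H1 in auto)
  then obtain u where u: "u > 0" "real CARD('p) * H1 u + 2 * u * H2 u > 0" by blast
  \<comment> \<open>Any point of norm \<open>sqrt u\<close> serves, so the coordinate direction is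
    left arbitrary.\<close>
  define y :: "real ^ 'p" where "y = sqrt u *\<^sub>R axis undefined 1"
  have y: "(norm y)\<^sup>2 = u" using u by (simp add: y_def power_mult_distrib)
  then have "y \<noteq> 0" using u by auto
  then have "laplacian (\<lambda>y. H ((norm y)\<^sup>2)) y = 2 * (real CARD('p) * H1 u + 2 * u * H2 u)"
    using laplacian_radial[of y H H1 H2] H H1 y by (simp add: algebra_simps)
  then have "laplacian (\<lambda>y. sqrt (m y)) y > 0"
    using u unfolding m H_def by simp
  then show ?thesis by (meson not_le)
qed

end
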